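(* Let $0<r_0<r_1<r_2$, $p(r)=\frac1r$, $\rho(r)=\frac1r\left(\frac{r^2}{r_0^2}-1\right)$ on $[r_1,r_2]$, $\mathcal H=L^2_\rho(r_1,r_2)$. Let $\{R_m\}_{m\ge1}$ be the orthonormal basis of $\mathcal H$ of real eigenfunctions of $-(pR')'=\lambda^2\rho R$, $R(r_1)=R(r_2)=0$, ordered by increasing eigenvalue and with sign chosen so that $R_m'(r_1)>0$. Let $\xi(r)=\int_{r_1}^r\sqrt{s^2/r_0^2-1}\,ds$, $L=\xi(r_2)$, and $$\hat R_m^{(LG)}(r)=\sqrt{\frac2L}\,\frac{1}{(p(r)\rho(r))^{1/4}}\sin\left(\frac{\pi m}{L}\xi(r)\right),\qquad m\ge1.$$ Then, as $m\to\infty$: (i) $\|R_m-\hat R_m^{(LG)}\|_\rho=O(m^{-1})$; (ii) $\langle R_m,\hat R_k^{(LG)}\rangle_\rho=O(m^{-1})$ for $k\ne m$; (iii) the coefficients $c_{mk}=\langle\hat R_m^{(LG)},R_k\rangle_\rho$ of the expansion $\hat R_m^{(LG)}=\sum_{k\ge1}c_{mk}R_k$ satisfy $c_{mm}=1+O(m^{-1})$ and $c_{mk}=O(m^{-1})$ for $k\ne m$; (iv) if $\varphi\in C^3[r_1,r_2]$ with $\varphi^{(4)}\in L^2_\rho(r_1,r_2)$ and $\psi\in C^1[r_1,r_2]$ with $\psi''\in L^2_\rho(r_1,r_2)$, then $$\langle\varphi,R_m\rangle_\rho-\langle\varphi,\hat R_m^{(LG)}\rangle_\rho=O(m^{-1}),\qquad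 \langle\psi,R_m\rangle_\rho-\langle\psi,\hat R_m^{(LG)}\rangle_\rho=O(m^{-1}).$$
   Context: $\langle f,g\rangle_\rho=\int_{r_1}^{r_2}f\overline g\,\rho\,dr$ and $\|f\|_\rho=\langle f,f\rangle_\rho^{1/2}$. The eigenvalue problem is a regular self-adjoint Sturm–Liouville problem with discrete positive spectrum. In (iv), $\varphi^{(4)}$ and $\psi''$ are weak derivatives. *)

theory Defs
  imports "HOL-Analysis.Analysis" "HOL-Library.Landau_Symbols"
begin

definition p_coeff :: "real \<Rightarrow> real"
  where "p_coeff r = 1 / r"

definition rho :: "real \<Rightarrow> real \<Rightarrow> real"
  where "rho r0 r = (1 / r) * (r\<^sup>2 / r0\<^sup>2 - 1)"

definition inner_rho ::
  "real \<Rightarrow> real \<Rightarrow> real \<Rightarrow> (real \<Rightarrow> complex) \<Rightarrow> (real \<Rightarrow> complex) \<Rightarrow> complex"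
  where "inner_rho r0 r1 r2 f g =
    (LINT r|lebesgue_on {r1..r2}. f r * cnj (g r) * complex_of_real (rho r0 r))"

definition norm_rho :: "real \<Rightarrow> real \<Rightarrow> real \<Rightarrow> (real \<Rightarrow> complex) \<Rightarrow> real"
  where "norm_rho r0 r1 r2 f = sqrt (Re (inner_rho r0 r1 r2 f f))"

text \<open>Functions rather than classes modulo equality almost everywhere.\<close>

definition L2_rho :: "real \<Rightarrow> real \<Rightarrow> real \<Rightarrow> (real \<Rightarrow> complex) set"
  where "L2_rho r0 r1 r2 =
    {f. f \<in> borel_measurable (lebesgue_on {r1..r2}) \<and>
        integrable (lebesgue_on {r1..r2}) (\<lambda>r. (cmod (f r))\<^sup>2 * rho r0 r)}"

text \<open>Families are indexed by \<open>m \<ge> 1\<close>; the value at index 0 is irrelevant.\<close>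

definition expands_in_rho ::
  "real \<Rightarrow> real \<Rightarrow> real \<Rightarrow> (real \<Rightarrow> complex) \<Rightarrow> (nat \<Rightarrow> complex) \<Rightarrow> (nat \<Rightarrow> real \<Rightarrow> complex) \<Rightarrow> bool"
  where "expands_in_rho r0 r1 r2 f c e \<longleftrightarrow>
    (\<lambda>N. norm_rho r0 r1 r2 (\<lambda>r. f r - (\<Sum>k=1..N. c k * e k r))) \<longlonglongrightarrow> 0"

definition orthonormal_basis_rho ::
  "real \<Rightarrow> real \<Rightarrow> real \<Rightarrow> (nat \<Rightarrow> real \<Rightarrow> complex) \<Rightarrow> bool"
  where "orthonormal_basis_rho r0 r1 r2 e \<longleftrightarrow>
    (\<forall>m\<ge>1. e m \<in> L2_rho r0 r1 r2) \<and>
    (\<forall>m\<ge>1. \<forall>k\<ge>1. inner_rho r0 r1 r2 (e m) (e k) = (if m = k then 1 else 0)) \<and>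
    (\<forall>f\<in>L2_rho r0 r1 r2. expands_in_rho r0 r1 r2 f (\<lambda>k. inner_rho r0 r1 r2 f (e k)) e)"

text \<open>Classical solutions; derivatives at the endpoints are one-sided.\<close>

definition SL_eigenfunction :: "real \<Rightarrow> real \<Rightarrow> real \<Rightarrow> real \<Rightarrow> (real \<Rightarrow> real) \<Rightarrow> bool"
  where "SL_eigenfunction r0 r1 r2 lam R \<longleftrightarrow>
    R differentiable_on {r1..r2} \<and>
    (\<forall>r\<in>{r1..r2}.
      ((\<lambda>s. p_coeff s * vector_derivative R (at s within {r1..r2}))
        has_real_derivative - (lam\<^sup>2 * rho r0 r * R r)) (at r within {r1..r2})) \<and>
    R r1 = 0 \<and> R r2 = 0 \<and> (\<exists>r\<in>{r1..r2}. R r \<noteq> 0)"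

definition xi :: "real \<Rightarrow> real \<Rightarrow> real \<Rightarrow> real"
  where "xi r0 r1 r = integral {r1..r} (\<lambda>s. sqrt (s\<^sup>2 / r0\<^sup>2 - 1))"

definition R_LG :: "real \<Rightarrow> real \<Rightarrow> real \<Rightarrow> nat \<Rightarrow> real \<Rightarrow> real"
  where "R_LG r0 r1 r2 m r =
    (let L = xi r0 r1 r2 in
      sqrt (2 / L) * (1 / (p_coeff r * rho r0 r) powr (1/4)) * sin (pi * real m / L * xi r0 r1 r))"

definition Ck_on :: "nat \<Rightarrow> real \<Rightarrow> real \<Rightarrow> (real \<Rightarrow> complex) \<Rightarrow> bool"
  where "Ck_on n a b f \<longleftrightarrow>
    (\<exists>D :: nat \<Rightarrow> real \<Rightarrow> complex.
      (\<forall>x\<in>{a..b}. D 0 x = f x) \<and>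
      (\<forall>j<n. \<forall>x\<in>{a..b}. (D j has_vector_derivative D (Suc j) x) (at x within {a..b})) \<and>
      continuous_on {a..b} (D n))"

definition test_function :: "real \<Rightarrow> real \<Rightarrow> (real \<Rightarrow> real) \<Rightarrow> bool"
  where "test_function a b \<eta> \<longleftrightarrow>
    (\<forall>n x. (deriv ^^ n) \<eta> differentiable (at x)) \<and>
    (\<exists>c d. a < c \<and> c \<le> d \<and> d < b \<and> (\<forall>x. x \<notin> {c..d} \<longrightarrow> \<eta> x = 0))"

text \<open>\<open>g\<close> is the \<open>n\<close>-th weak derivative of \<open>f\<close> on the open interval from \<open>a\<close> to \<open>b\<close>;
  both functions are required to be locally integrable there.\<close>

definition weak_derivative ::
  "nat \<Rightarrow> real \<Rightarrow> real \<Rightarrow> (real \<Rightarrow> complex) \<Rightarrow> (real \<Rightarrow> complex) \<Rightarrow> bool"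
  where "weak_derivative n a b f g \<longleftrightarrow>
    (\<forall>c d. a < c \<longrightarrow> d < b \<longrightarrow>
       f absolutely_integrable_on {c..d} \<and> g absolutely_integrable_on {c..d}) \<and>
    (\<forall>\<eta>. test_function a b \<eta> \<longrightarrow>
       (LINT x|lebesgue_on {a..b}. f x * complex_of_real ((deriv ^^ n) \<eta> x)) =
       (-1) ^ n * (LINT x|lebesgue_on {a..b}. g x * complex_of_real (\<eta> x)))"

end

(* In the variable X = xi(r) and with w = (p rho)^(1/4) R the eigenvalue problem becomes
   -w'' + Q w = lam^2 w with Dirichlet conditions and bounded Q, and R_LG becomes the normalised sine;
   all computations are kept in the variable r, with weight h = X'.
   With mu_m = pi m / L, the numbering is controlled by |lam_m^2 - mu_m^2| <= sup |Q|, obtained from two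
   dimension counts: some combination of w_1, ..., w_m vanishes at the nodes of the m-th sine, so that
   Wirtinger's inequality applies on every nodal interval; and some combination of the first m sines is
   orthogonal to w_1, ..., w_(m-1), so that by completeness its energy is at least lam_m^2.
   Variation of constants then gives w_m = D_m sin(mu_m X) + O(1/m) uniformly, and normalisation and the
   sign convention determine D_m up to O(1/m). All claims follow by Cauchy-Schwarz from the resulting
   bound on the norm of R_m - R_LG,m. *)
theory Submission
  imports Defs
begin

section \<open>Dirichlet eigenfunctions in Liouville normal form\<close>

text \<open>The ordering of the eigenvalues alone does not say which \<open>mu n\<close> belongs to
  \<open>lam n\<close>. Oscillation theory would count zeros of eigenfunctions; here a count of
  linear equations against unknowns takes its place. The lower bound lives in the span of the first
  n eigenfunctions. The upper bound must exclude that the given family skips an eigenvalue, and this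
  is what completeness supplies. Dividing by lam_n + mu_n turns the bounded error of the squares
  into O(1/n), and since X is bounded the phase error is O(1/n) on the whole interval. The integral
  term in variation of constants is controlled by the L^1 norm of w_n, which normalisation bounds;
  this replaces a prior sup bound on w_n. One circularity remains: the estimate for D_n - 1 contains
  D_n itself, and it is closed by absorption for large n. Keeping r as the variable means that the
  inverse of X is never formed.\<close>

lemma homogeneous_system_nontrivial:
  fixes A :: "nat \<Rightarrow> 'b \<Rightarrow> 'a :: field"
  assumes "finite J" and "m < card J"
  shows "\<exists>c. (\<exists>j\<in>J. c j \<noteq> 0) \<and> (\<forall>i<m. (\<Sum>j\<in>J. c j * A i j) = 0)"
  using assms
proof (induction m arbitrary: A J)
  case 0
  then obtain j where "j \<in> J" by (metis card.empty ex_in_conv less_irrefl)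
  then show ?case by (intro exI[of _ "\<lambda>_. 1"]) auto
next
  case (Suc m)
  show ?case
  proof (cases "\<forall>j\<in>J. A m j = 0")
    case True
    obtain c where "\<exists>j\<in>J. c j \<noteq> 0" "\<forall>i<m. (\<Sum>j\<in>J. c j * A i j) = 0"
      using Suc.IH[of J A] Suc.prems by auto
    with True show ?thesis
      by (intro exI[of _ c]) (auto simp: less_Suc_eq)
  next
    case False
    then obtain k where k: "k \<in> J" "A m k \<noteq> 0" by blast
    \<comment> \<open>Gaussian elimination with pivot \<open>A m k\<close>: equation
      \<open>m\<close> is solved for the unknown \<open>k\<close>, which gives \<open>t\<close>
      below, and \<open>A'\<close> is the system left for the other unknowns.\<close>
    define A' where "A' = (\<lambda>i j. A i j - A i k * A m j / A m k)"
    have "m < card (J - {k})" using Suc.prems k by simp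
    then obtain c where c: "\<exists>j\<in>J-{k}. c j \<noteq> 0" "\<forall>i<m. (\<Sum>j\<in>J-{k}. c j * A' i j) = 0"
      using Suc.IH[of "J - {k}" A'] Suc.prems by auto
    define t where "t = - (\<Sum>j\<in>J-{k}. c j * A m j) / A m k"
    define c' where "c' = c(k := t)"
    have split: "(\<Sum>j\<in>J. c' j * A i j) = t * A i k + (\<Sum>j\<in>J-{k}. c j * A i j)" for i
      using k Suc.prems by (subst sum.remove[of J k]) (auto simp: c'_def intro!: sum.cong)
    have "(\<Sum>j\<in>J. c' j * A i j) = 0" if "i < m" for i
    proof -
      have "(\<Sum>j\<in>J-{k}. c j * A i j) - A i k / A m k * (\<Sum>j\<in>J-{k}. c j * A m j) = 0"
        using c(2) that
        by (simp add: A'_def right_diff_distrib sum_subtractf sum_distrib_left algebra_simps)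
      then show ?thesis by (simp add: split t_def field_simps)
    qed
    moreover have "(\<Sum>j\<in>J. c' j * A m j) = 0"
      using k by (simp add: split t_def)
    moreover have "\<exists>j\<in>J. c' j \<noteq> 0" using c(1) by (auto simp: c'_def)
    ultimately show ?thesis by (intro exI[of _ c']) (auto simp: less_Suc_eq)
  qed
qed

lemma abs_sin_diff_le: "\<bar>sin x - sin y\<bar> \<le> \<bar>x - y\<bar>" for x y :: real
proof -
  have "\<bar>sin x - sin y\<bar> = 2 * \<bar>sin ((x - y) / 2)\<bar> * \<bar>cos ((x + y) / 2)\<bar>"
    by (simp add: sin_diff_sin abs_mult)
  also have "\<dots> \<le> 2 * \<bar>(x - y) / 2\<bar> * 1"
    by (intro mult_mono abs_sin_x_le_abs_x) auto
  finally show ?thesis by simp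
qed

section \<open>Calculus and inner product in the variable X, and the sine system\<close>

locale liouville_interval =
  fixes a b :: real and X h Q :: "real \<Rightarrow> real" and C :: real
  assumes ab: "a < b"
    and X_a: "X a = 0"
    and X_deriv: "r \<in> {a..b} \<Longrightarrow> (X has_real_derivative h r) (at r within {a..b})"
    and h_cont: "continuous_on {a..b} h"
    and h_pos: "r \<in> {a..b} \<Longrightarrow> 0 < h r"
    and Q_cont: "continuous_on {a..b} Q"
    and Q_bound: "r \<in> {a..b} \<Longrightarrow> \<bar>Q r\<bar> \<le> C"
begin

definition ip :: "(real \<Rightarrow> real) \<Rightarrow> (real \<Rightarrow> real) \<Rightarrow> real"
  where "ip f g = integral {a..b} (\<lambda>r. f r * g r * h r)"

definition len :: real where "len = X b"

definition mu :: "nat \<Rightarrow> real" where "mu n = pi * real n / len"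

definition sine :: "nat \<Rightarrow> real \<Rightarrow> real"
  where "sine n r = sqrt (2 / len) * sin (mu n * X r)"

definition cosine :: "nat \<Rightarrow> real \<Rightarrow> real"
  where "cosine n r = sqrt (2 / len) * mu n * cos (mu n * X r)"

text \<open>\<open>g\<close> is the derivative of \<open>f\<close> with respect to the variable \<open>X\<close>.\<close>

definition has_X_deriv :: "(real \<Rightarrow> real) \<Rightarrow> (real \<Rightarrow> real) \<Rightarrow> bool"
  where "has_X_deriv f g \<longleftrightarrow>
    (\<forall>r\<in>{a..b}. (f has_real_derivative g r * h r) (at r within {a..b}))"

lemma X_cont: "continuous_on {a..b} X"
  using X_deriv by (meson DERIV_isCont DERIV_continuous continuous_on_eq_continuous_within)

lemma has_X_deriv_cont: "has_X_deriv f g \<Longrightarrow> continuous_on {a..b} f"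
  unfolding has_X_deriv_def
  by (meson DERIV_continuous continuous_on_eq_continuous_within)

lemma X_strict_mono:
  assumes "a \<le> s" "s < t" "t \<le> b"
  shows "X s < X t"
proof (rule DERIV_pos_imp_increasing_open[OF assms(2)])
  fix x assume x: "s < x" "x < t"
  then have "(X has_real_derivative h x) (at x)"
    using X_deriv[of x] assms at_within_Icc_at[of a x b] by auto
  then show "\<exists>y. (X has_real_derivative y) (at x) \<and> 0 < y" using h_pos[of x] x assms by auto
qed (use X_cont assms in \<open>auto intro: continuous_on_subset\<close>)

lemma len_pos: "0 < len"
  using X_strict_mono[of a b] ab X_a by (simp add: len_def)

lemma X_range: "r \<in> {a..b} \<Longrightarrow> X r \<in> {0..len}"
  using X_strict_mono[of a r] X_strict_mono[of r b] X_a ab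
  by (cases "r = a"; cases "r = b") (auto simp: len_def intro: less_imp_le)

lemma X_deriv_integral:
  assumes "has_X_deriv F g" "a \<le> s" "s \<le> t" "t \<le> b"
  shows "((\<lambda>r. g r * h r) has_integral (F t - F s)) {s..t}"
proof (rule fundamental_theorem_of_calculus[OF assms(3)])
  fix x assume "x \<in> {s..t}"
  then have "(F has_real_derivative g x * h x) (at x within {s..t})"
    using assms unfolding has_X_deriv_def
    by (meson DERIV_subset atLeastAtMost_iff atLeastatMost_subset_iff order_trans)
  then show "(F has_vector_derivative g x * h x) (at x within {s..t})"
    by (simp add: has_real_derivative_iff_has_vector_derivative)
qed

lemma has_X_deriv_mult:
  "has_X_deriv f f' \<Longrightarrow> has_X_deriv g g' \<Longrightarrow> has_X_deriv (\<lambda>r. f r * g r) (\<lambda>r. f' r * g r + f r * g' r)"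
  unfolding has_X_deriv_def by (auto intro!: derivative_eq_intros simp: algebra_simps)

lemma has_X_deriv_sum:
  assumes "\<And>j. j \<in> J \<Longrightarrow> has_X_deriv (f j) (g j)"
  shows "has_X_deriv (\<lambda>r. \<Sum>j\<in>J. c j * f j r) (\<lambda>r. \<Sum>j\<in>J. c j * g j r)"
  unfolding has_X_deriv_def
proof
  fix r assume "r \<in> {a..b}"
  then have "((\<lambda>r. \<Sum>j\<in>J. c j * f j r) has_real_derivative (\<Sum>j\<in>J. c j * (g j r * h r))) (at r within {a..b})"
    using assms unfolding has_X_deriv_def
    by (intro DERIV_sum DERIV_cmult) auto
  then show "((\<lambda>r. \<Sum>j\<in>J. c j * f j r) has_real_derivative (\<Sum>j\<in>J. c j * g j r) * h r) (at r within {a..b})"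
    by (simp add: sum_distrib_right mult.assoc)
qed

lemma has_X_deriv_compose:
  assumes "\<And>r. r \<in> {a..b} \<Longrightarrow> (G has_real_derivative G' (X r)) (at (X r))"
  shows "has_X_deriv (\<lambda>r. G (X r)) (\<lambda>r. G' (X r))"
  unfolding has_X_deriv_def using assms X_deriv by (blast intro: DERIV_chain2)

lemma sine_X_deriv: "has_X_deriv (sine n) (cosine n)"
  unfolding sine_def cosine_def
  by (rule has_X_deriv_compose) (auto intro!: derivative_eq_intros)

lemma cosine_X_deriv: "has_X_deriv (cosine n) (\<lambda>r. - (mu n)\<^sup>2 * sine n r)"
  unfolding sine_def cosine_def
  by (rule has_X_deriv_compose) (auto intro!: derivative_eq_intros simp: power2_eq_square)

lemma sine_cont: "continuous_on {a..b} (sine n)"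
  using sine_X_deriv has_X_deriv_cont by blast

lemma cosine_cont: "continuous_on {a..b} (cosine n)"
  using cosine_X_deriv has_X_deriv_cont by blast

lemma mu_len: "mu n * len = pi * n"
  using len_pos by (simp add: mu_def)

lemma mu_mono: "m \<le> n \<Longrightarrow> mu m \<le> mu n"
  using len_pos by (simp add: mu_def divide_right_mono)

lemma mu_nonneg: "0 \<le> mu n"
  using len_pos by (simp add: mu_def)

lemma sine_a: "sine n a = 0" by (simp add: sine_def X_a)

lemma sine_b: "sine n b = 0"
  using mu_len[of n] by (simp add: sine_def len_def[symmetric] mult.commute)

lemma abs_sine_le: "\<bar>sine n r\<bar> \<le> sqrt (2 / len)"
  using len_pos by (simp add: sine_def abs_mult mult_left_le)

lemma ip_integrable:
  assumes "continuous_on {a..b} f" "continuous_on {a..b} g"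
  shows "(\<lambda>r. f r * g r * h r) integrable_on {a..b}"
  using assms h_cont by (intro integrable_continuous_real continuous_intros)

lemma ip_commute: "ip f g = ip g f"
  by (simp add: ip_def mult.commute)

lemma ip_diff_left:
  assumes "continuous_on {a..b} f" "continuous_on {a..b} g" "continuous_on {a..b} k"
  shows "ip (\<lambda>r. f r - g r) k = ip f k - ip g k"
  unfolding ip_def using assms
  by (subst integral_diff[symmetric]) (auto intro!: ip_integrable simp: left_diff_distrib)

lemma ip_cmult_left: "ip (\<lambda>r. c * f r) g = c * ip f g"
  unfolding ip_def by (simp add: mult.assoc)

lemma ip_sum_left:
  assumes "finite J" "\<And>j. j \<in> J \<Longrightarrow> continuous_on {a..b} (f j)" "continuous_on {a..b} g"
  shows "ip (\<lambda>r. \<Sum>j\<in>J. c j * f j r) g = (\<Sum>j\<in>J. c j * ip (f j) g)"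
proof -
  have "ip (\<lambda>r. \<Sum>j\<in>J. c j * f j r) g
      = integral {a..b} (\<lambda>r. \<Sum>j\<in>J. c j * (f j r * g r * h r))"
    by (simp add: ip_def sum_distrib_right mult.assoc)
  also have "\<dots> = (\<Sum>j\<in>J. integral {a..b} (\<lambda>r. c j * (f j r * g r * h r)))"
    using assms ip_integrable by (intro integral_sum integrable_on_mult_right) auto
  finally show ?thesis by (simp add: ip_def)
qed

lemma ip_sum_right:
  assumes "finite J" "\<And>j. j \<in> J \<Longrightarrow> continuous_on {a..b} (f j)" "continuous_on {a..b} g"
  shows "ip g (\<lambda>r. \<Sum>j\<in>J. c j * f j r) = (\<Sum>j\<in>J. c j * ip g (f j))"
  using ip_sum_left[OF assms] by (simp add: ip_commute)

lemma ip_mono: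
  assumes "continuous_on {a..b} f" "continuous_on {a..b} g"
    "continuous_on {a..b} f'" "continuous_on {a..b} g'"
    "\<And>r. r \<in> {a..b} \<Longrightarrow> f r * g r \<le> f' r * g' r"
  shows "ip f g \<le> ip f' g'"
  unfolding ip_def using assms h_pos
  by (intro integral_le ip_integrable mult_right_mono) (auto intro: less_imp_le)

lemma ip_nonneg: "continuous_on {a..b} f \<Longrightarrow> 0 \<le> ip f f"
  using ip_mono[of "\<lambda>_. 0" "\<lambda>_. 0" f f] by (simp add: ip_def)

lemma ip_const: "ip (\<lambda>_. c) (\<lambda>_. d) = c * d * len"
proof -
  have "has_X_deriv (\<lambda>r. c * d * X r) (\<lambda>_. c * d)"
    by (rule has_X_deriv_compose) (auto intro!: derivative_eq_intros)
  from integral_unique[OF X_deriv_integral[OF this, of a b]] ab show ?thesis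
    by (simp only: ip_def X_a len_def)
qed

lemma ip_Cauchy_Schwarz:
  assumes f: "continuous_on {a..b} f" and g: "continuous_on {a..b} g"
  shows "(ip f g)\<^sup>2 \<le> ip f f * ip g g"
proof -
  have pos: "0 \<le> ip f f - 2 * t * ip f g + t\<^sup>2 * ip g g" for t
  proof -
    have "0 \<le> ip (\<lambda>r. f r - t * g r) (\<lambda>r. f r - t * g r)"
      using f g by (intro ip_nonneg continuous_intros)
    also have "\<dots> = ip f (\<lambda>r. f r - t * g r) - t * ip g (\<lambda>r. f r - t * g r)"
      using f g by (subst ip_diff_left) (auto intro!: continuous_intros simp: ip_cmult_left)
    also have "ip f (\<lambda>r. f r - t * g r) = ip f f - t * ip f g"
      using f g by (subst ip_commute, subst ip_diff_left)
        (auto intro!: continuous_intros simp: ip_cmult_left ip_commute[of g f])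
    also have "ip g (\<lambda>r. f r - t * g r) = ip f g - t * ip g g"
      using f g by (subst ip_commute, subst ip_diff_left)
        (auto intro!: continuous_intros simp: ip_cmult_left)
    finally show ?thesis by (simp add: algebra_simps power2_eq_square)
  qed
  show ?thesis
  proof (cases "ip g g = 0")
    case True
    \<comment> \<open>With \<open>ip g g = 0\<close> the quadratic is affine in t, and at this t it
      would take the value -1.\<close>
    have "ip f g = 0"
      using pos[of "(ip f f + 1) / (2 * ip f g)"] True by (cases "ip f g = 0") auto
    then show ?thesis using True by simp
  next
    case False
    then have "0 < ip g g" using ip_nonneg[OF g] by linarith
    then show ?thesis using pos[of "ip f g / ip g g"]
      by (simp add: field_simps power2_eq_square)
  qed
qed

lemma ip_by_parts:
  assumes "has_X_deriv f f'" "has_X_deriv g g'" "continuous_on {a..b} f'" "continuous_on {a..b} g'"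
  shows "ip f' g + ip f g' = f b * g b - f a * g a"
proof -
  have c: "continuous_on {a..b} f" "continuous_on {a..b} g"
    using assms has_X_deriv_cont by blast+
  have "((\<lambda>r. (f' r * g r + f r * g' r) * h r) has_integral (f b * g b - f a * g a)) {a..b}"
    using X_deriv_integral[OF has_X_deriv_mult[OF assms(1,2)], of a b] ab by simp
  moreover have "ip f' g + ip f g' = integral {a..b} (\<lambda>r. (f' r * g r + f r * g' r) * h r)"
    unfolding ip_def using assms c
    by (subst integral_add[symmetric]) (auto intro!: ip_integrable simp: distrib_right)
  ultimately show ?thesis by (simp add: integral_unique)
qed

text \<open>Integration by parts replaces explicit trigonometric integrals. For different indices,
  \<open>energy\<close> read in both orders gives the same inner product with two different factors.
  For equal indices, sin^2 + cos^2 = 1 makes the two equal energies add up to 2 mu^2.\<close>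

lemma sine_orthonormal:
  assumes "m \<ge> 1" "n \<ge> 1"
  shows "ip (sine m) (sine n) = (if m = n then 1 else 0)"
proof -
  have energy: "ip (cosine i) (cosine j) = (mu j)\<^sup>2 * ip (sine i) (sine j)" for i j
  proof -
    have "ip (sine i) (\<lambda>r. - (mu j)\<^sup>2 * sine j r) = - (mu j)\<^sup>2 * ip (sine i) (sine j)"
      using ip_cmult_left[of "- (mu j)\<^sup>2" "sine j" "sine i"] by (simp add: ip_commute)
    then show ?thesis
      using ip_by_parts[OF sine_X_deriv[of i] cosine_X_deriv[of j] cosine_cont]
        sine_cont[of j] by (simp add: sine_a sine_b continuous_intros)
  qed
  have mu_pos: "0 < mu n" if "n \<ge> 1" for n using that len_pos by (simp add: mu_def)
  show ?thesis
  proof (cases "m = n")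
    case True
    have s2: "(sqrt (2 / len))\<^sup>2 = 2 / len" using len_pos by simp
    have "(mu n)\<^sup>2 * ip (sine n) (sine n) + ip (cosine n) (cosine n)
        = ip (\<lambda>r. mu n * sine n r) (\<lambda>r. mu n * sine n r) + ip (cosine n) (cosine n)"
      by (simp add: ip_def power2_eq_square mult_ac flip: integral_mult_right)
    also have "\<dots> = integral {a..b} (\<lambda>r. ((mu n * sine n r)\<^sup>2 + (cosine n r)\<^sup>2) * h r)"
      unfolding ip_def using sine_cont[of n] cosine_cont[of n]
      by (subst integral_add[symmetric])
        (auto intro!: ip_integrable continuous_intros simp only: distrib_right power2_eq_square)
    also have "(\<lambda>r. ((mu n * sine n r)\<^sup>2 + (cosine n r)\<^sup>2) * h r)
        = (\<lambda>r. ((mu n)\<^sup>2 * (2 / len)) * 1 * h r)"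
    proof
      fix r
      have "(mu n * sine n r)\<^sup>2 + (cosine n r)\<^sup>2
          = (mu n)\<^sup>2 * (sqrt (2 / len))\<^sup>2 * ((sin (mu n * X r))\<^sup>2 + (cos (mu n * X r))\<^sup>2)"
        by (simp only: sine_def cosine_def power_mult_distrib) (simp only: algebra_simps)
      then show "((mu n * sine n r)\<^sup>2 + (cosine n r)\<^sup>2) * h r = ((mu n)\<^sup>2 * (2 / len)) * 1 * h r"
        by (simp add: s2 del: real_sqrt_divide)
    qed
    also have "integral {a..b} \<dots> = 2 * (mu n)\<^sup>2"
      using ip_const[of "(mu n)\<^sup>2 * (2 / len)" 1] len_pos by (simp add: ip_def)
    finally have "2 * ((mu n)\<^sup>2 * ip (sine n) (sine n)) = 2 * (mu n)\<^sup>2"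
      using energy[of n n] by simp
    then show ?thesis using True mu_pos[OF assms(2)] by simp
  next
    case False
    have "(mu m)\<^sup>2 \<noteq> (mu n)\<^sup>2"
      using False mu_pos assms len_pos by (simp add: power2_eq_iff_nonneg mu_nonneg) (simp add: mu_def)
    moreover have "(mu n)\<^sup>2 * ip (sine m) (sine n) = (mu m)\<^sup>2 * ip (sine m) (sine n)"
      using energy[of m n] energy[of n m] by (simp add: ip_commute)
    ultimately show ?thesis using False by simp
  qed
qed

section \<open>Wirtinger's inequality on an interval and on the nodal partition\<close>

text \<open>Completing the square with \<open>\<mu> tan(\<mu> (X - c))\<close>, \<open>c\<close> the midpoint, which has no pole as long
  as \<open>\<mu>\<close> is below the critical value; the critical case follows in the limit.\<close>

lemma Wirtinger:
  assumes fg: "has_X_deriv f g" and g: "continuous_on {a..b} g"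
    and st: "a \<le> s" "s < t" "t \<le> b" and zero: "f s = 0" "f t = 0"
  shows "(pi / (X t - X s))\<^sup>2 * integral {s..t} (\<lambda>r. (f r)\<^sup>2 * h r) \<le> integral {s..t} (\<lambda>r. (g r)\<^sup>2 * h r)"
proof (rule field_le_mult_one_interval)
  fix z :: real assume z: "0 < z" "z < 1"
  define d where "d = X t - X s"
  define c where "c = (X s + X t) / 2"
  define \<nu> where "\<nu> = sqrt z * (pi / d)"
  have d: "0 < d" using X_strict_mono st by (simp add: d_def)
  have sub: "{s..t} \<subseteq> {a..b}" using st by auto
  have cos_pos: "0 < cos (\<nu> * (X r - c))" if r: "r \<in> {s..t}" for r
  proof (rule cos_gt_zero_pi)
    have "X s \<le> X r" "X r \<le> X t"
      using X_strict_mono[of s r] X_strict_mono[of r t] r st by (cases "r = s"; cases "r = t"; auto)+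
    then have "\<bar>X r - c\<bar> \<le> d / 2" by (auto simp: d_def c_def abs_if field_simps)
    moreover have nu: "0 < \<nu>" "\<nu> < pi / d"
      using z d mult_strict_right_mono[of "sqrt z" 1 "pi / d"] by (auto simp: \<nu>_def)
    ultimately have "\<nu> * \<bar>X r - c\<bar> \<le> \<nu> * (d / 2)" by (intro mult_left_mono) auto
    also have "\<dots> < pi / 2" using nu d by (simp add: field_simps)
    finally have "\<bar>\<nu> * (X r - c)\<bar> < pi / 2" using nu by (simp add: abs_mult)
    then show "- (pi / 2) < \<nu> * (X r - c)" "\<nu> * (X r - c) < pi / 2" by auto
  qed
  \<comment> \<open>With respect to X, \<open>T\<close> solves the Riccati equation T' = \<nu>^2 +
    T^2. Hence (g + T f)^2 = g^2 - \<nu>^2 f^2 + (T f^2)', and the last term integrates to 0 because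
    f vanishes at both ends.\<close>
  define T where "T = (\<lambda>r. \<nu> * tan (\<nu> * (X r - c)))"
  have T_deriv: "(T has_real_derivative (\<nu>\<^sup>2 + (T r)\<^sup>2) * h r) (at r within {s..t})"
    if r: "r \<in> {s..t}" for r
  proof -
    have X': "(X has_real_derivative h r) (at r within {s..t})"
      using X_deriv[of r] r sub by (meson DERIV_subset subsetD)
    have nz: "cos (\<nu> * (X r - c)) \<noteq> 0" using cos_pos[OF r] by simp
    have "(T has_real_derivative \<nu> * (inverse ((cos (\<nu> * (X r - c)))\<^sup>2) * (\<nu> * h r))) (at r within {s..t})"
      unfolding T_def using nz
      by (auto intro!: derivative_eq_intros DERIV_chain2[OF DERIV_tan] X')
    moreover have "inverse ((cos (\<nu> * (X r - c)))\<^sup>2) = 1 + (tan (\<nu> * (X r - c)))\<^sup>2"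
      using tan_sec[OF nz] by (simp add: power_inverse)
    ultimately show ?thesis by (simp add: T_def algebra_simps power2_eq_square)
  qed
  have T_cont: "continuous_on {s..t} T"
    using T_deriv by (meson DERIV_continuous continuous_on_eq_continuous_within)
  have f_deriv: "(f has_real_derivative g r * h r) (at r within {s..t})" if "r \<in> {s..t}" for r
    using fg that sub unfolding has_X_deriv_def by (meson DERIV_subset subsetD)
  note cont = T_cont continuous_on_subset[OF has_X_deriv_cont[OF fg] sub]
    continuous_on_subset[OF g sub] continuous_on_subset[OF h_cont sub]
  have "((\<lambda>r. (\<nu>\<^sup>2 + (T r)\<^sup>2) * h r * (f r)\<^sup>2 + T r * (2 * f r * (g r * h r))) has_integral
      T t * (f t)\<^sup>2 - T s * (f s)\<^sup>2) {s..t}"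
    using st(2) T_deriv f_deriv
    by (intro fundamental_theorem_of_calculus)
      (auto intro!: derivative_eq_intros simp flip: has_real_derivative_iff_has_vector_derivative)
  then have I: "integral {s..t} (\<lambda>r. (\<nu>\<^sup>2 + (T r)\<^sup>2) * h r * (f r)\<^sup>2 + T r * (2 * f r * (g r * h r))) = 0"
    using zero by (simp add: integral_unique)
  have "0 \<le> integral {s..t} (\<lambda>r. (g r + T r * f r)\<^sup>2 * h r)"
    using cont h_pos sub
    by (intro integral_nonneg integrable_continuous_real continuous_intros)
      (auto simp: less_imp_le)
  also have "\<dots> = integral {s..t} (\<lambda>r. ((g r)\<^sup>2 * h r - \<nu>\<^sup>2 * ((f r)\<^sup>2 * h r))
        + ((\<nu>\<^sup>2 + (T r)\<^sup>2) * h r * (f r)\<^sup>2 + T r * (2 * f r * (g r * h r))))"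
    by (rule arg_cong[where f = "integral _"]) (auto simp: fun_eq_iff algebra_simps power2_eq_square)
  also have "\<dots> = (integral {s..t} (\<lambda>r. (g r)\<^sup>2 * h r) - \<nu>\<^sup>2 * integral {s..t} (\<lambda>r. (f r)\<^sup>2 * h r)) + 0"
    unfolding I[symmetric]
    using cont
    by (subst integral_add integral_diff, (auto intro!: integrable_continuous_real continuous_intros)[2])+ simp
  finally have "\<nu>\<^sup>2 * integral {s..t} (\<lambda>r. (f r)\<^sup>2 * h r) \<le> integral {s..t} (\<lambda>r. (g r)\<^sup>2 * h r)" by simp
  moreover have "\<nu>\<^sup>2 = z * (pi / d)\<^sup>2" using z unfolding \<nu>_def power_mult_distrib by simp
  ultimately show "z * ((pi / (X t - X s))\<^sup>2 * integral {s..t} (\<lambda>r. (f r)\<^sup>2 * h r))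
      \<le> integral {s..t} (\<lambda>r. (g r)\<^sup>2 * h r)" by (simp add: d_def mult.assoc)
qed

lemma X_inj: "s \<in> {a..b} \<Longrightarrow> t \<in> {a..b} \<Longrightarrow> X s = X t \<Longrightarrow> s = t"
  using X_strict_mono[of s t] X_strict_mono[of t s] by (cases s t rule: linorder_cases) auto

text \<open>The points t j are the zeros of \<open>sine n\<close>, since mu n * X (t j) = pi j; they
  come from the intermediate value theorem, and injectivity of X identifies the two outer
  ones.\<close>

lemma nodes_exist:
  assumes "n \<ge> 1"
  obtains t where "\<And>j. j \<le> n \<Longrightarrow> t j \<in> {a..b}" "\<And>j. j \<le> n \<Longrightarrow> X (t j) = len * real j / real n"
    "t 0 = a" "t n = b"
proof -
  have "\<exists>r. r \<in> {a..b} \<and> X r = len * real j / real n" if "j \<le> n" for j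
  proof -
    have "len * real j / real n \<le> len"
      using that assms len_pos by (simp add: divide_le_eq)
    then show ?thesis
      using IVT'[of X a "len * real j / real n" b] X_cont X_a ab len_pos by (auto simp: len_def)
  qed
  then obtain t where t: "\<And>j. j \<le> n \<Longrightarrow> t j \<in> {a..b} \<and> X (t j) = len * real j / real n"
    by metis
  moreover have "t 0 = a" using t[of 0] X_a ab by - (rule X_inj, auto)
  moreover have "t n = b" using t[of n] ab assms by - (rule X_inj, auto simp: len_def)
  ultimately show ?thesis using that by blast
qed

text \<open>Every nodal interval has X-length len / n, so the Wirtinger constant pi / (len / n) is
  \<open>mu n\<close> on each of them and the inequalities add up.\<close>

lemma nodal_Wirtinger:
  assumes n: "n \<ge> 1" and fg: "has_X_deriv f g" and g: "continuous_on {a..b} g"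
    and t: "\<And>j. j \<le> n \<Longrightarrow> t j \<in> {a..b}" "\<And>j. j \<le> n \<Longrightarrow> X (t j) = len * real j / real n"
      "t 0 = a" "t n = b"
    and zero: "\<And>j. j \<le> n \<Longrightarrow> f (t j) = 0"
  shows "(mu n)\<^sup>2 * ip f f \<le> ip g g"
proof -
  have f: "continuous_on {a..b} f" using fg has_X_deriv_cont by blast
  have int: "(\<lambda>r. (k r)\<^sup>2 * h r) integrable_on {a..c}" if "continuous_on {a..b} k" "c \<le> b" for k c
    using that h_cont by (intro integrable_continuous_real continuous_intros)
      (auto intro: continuous_on_subset)
  have "(mu n)\<^sup>2 * integral {a..t j} (\<lambda>r. (f r)\<^sup>2 * h r) \<le> integral {a..t j} (\<lambda>r. (g r)\<^sup>2 * h r)"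
    if "j \<le> n" for j
    using that
  proof (induction j)
    case 0
    then show ?case by (simp add: t)
  next
    case (Suc j)
    have gap: "X (t (Suc j)) - X (t j) = len / real n"
      using Suc.prems n by (simp add: t field_simps)
    then have "X (t j) < X (t (Suc j))" using len_pos n by (smt (verit) divide_pos_pos of_nat_0_less_iff less_le_trans zero_less_one)
    then have less: "t j < t (Suc j)"
      using X_strict_mono[of "t (Suc j)" "t j"] t(1)[of j] t(1)[of "Suc j"] Suc.prems
      by (cases "t j" "t (Suc j)" rule: linorder_cases) auto
    have "(mu n)\<^sup>2 * integral {t j..t (Suc j)} (\<lambda>r. (f r)\<^sup>2 * h r) \<le> integral {t j..t (Suc j)} (\<lambda>r. (g r)\<^sup>2 * h r)"
      using Wirtinger[OF fg g _ less] t(1)[of j] t(1)[of "Suc j"] zero[of j] zero[of "Suc j"] Suc.prems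
      by (simp add: gap mu_def)
    moreover have "integral {a..t (Suc j)} (\<lambda>r. (k r)\<^sup>2 * h r)
        = integral {a..t j} (\<lambda>r. (k r)\<^sup>2 * h r) + integral {t j..t (Suc j)} (\<lambda>r. (k r)\<^sup>2 * h r)"
      if "continuous_on {a..b} k" for k
      using int[OF that, of "t (Suc j)"] less t(1)[of j] t(1)[of "Suc j"] Suc.prems
      by (subst Henstock_Kurzweil_Integration.integral_combine) auto
    ultimately show ?case using Suc f g by (simp add: distrib_left)
  qed
  from this[of n] show ?thesis by (simp add: t ip_def power2_eq_square)
qed

section \<open>Norm and energy of orthonormal combinations\<close>

lemma orthonormal_coeff:
  assumes "finite J" "\<And>j. j \<in> J \<Longrightarrow> continuous_on {a..b} (e j)"
    "\<And>i j. i \<in> J \<Longrightarrow> j \<in> J \<Longrightarrow> ip (e i) (e j) = (if i = j then 1 else 0)" "k \<in> J"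
  shows "ip (\<lambda>r. \<Sum>j\<in>J. c j * e j r) (e k) = c k"
proof -
  have "ip (\<lambda>r. \<Sum>j\<in>J. c j * e j r) (e k) = (\<Sum>j\<in>J. c j * ip (e j) (e k))"
    using assms by (intro ip_sum_left) auto
  also have "\<dots> = (\<Sum>j\<in>J. if j = k then c j else 0)"
    using assms by (intro sum.cong) auto
  finally show ?thesis using assms by simp
qed

lemma orthonormal_norm:
  assumes "finite J" "\<And>j. j \<in> J \<Longrightarrow> continuous_on {a..b} (e j)"
    "\<And>i j. i \<in> J \<Longrightarrow> j \<in> J \<Longrightarrow> ip (e i) (e j) = (if i = j then 1 else 0)"
  shows "ip (\<lambda>r. \<Sum>j\<in>J. c j * e j r) (\<lambda>r. \<Sum>j\<in>J. c j * e j r) = (\<Sum>j\<in>J. (c j)\<^sup>2)"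
proof -
  define f where "f = (\<lambda>r. \<Sum>j\<in>J. c j * e j r)"
  have "continuous_on {a..b} f" unfolding f_def using assms by (intro continuous_intros) auto
  then have "ip f f = (\<Sum>j\<in>J. c j * ip f (e j))"
    by (subst (2) f_def) (use assms in \<open>auto intro: ip_sum_right\<close>)
  also have "\<dots> = (\<Sum>j\<in>J. (c j)\<^sup>2)"
    by (intro sum.cong refl)
      (simp add: f_def power2_eq_square orthonormal_coeff[OF assms(1,2,3)])
  finally show ?thesis by (simp only: f_def)
qed

lemma potential_bound:
  assumes "continuous_on {a..b} f"
  shows "\<bar>ip f (\<lambda>r. Q r * f r)\<bar> \<le> C * ip f f"
proof -
  have *: "- C * (f r * f r) \<le> Q r * (f r * f r)" "Q r * (f r * f r) \<le> C * (f r * f r)" if "r \<in> {a..b}" for r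
    using Q_bound[OF that] by (intro mult_right_mono, auto)+
  have "ip f (\<lambda>r. Q r * f r) \<le> ip (\<lambda>r. C * f r) f"
    by (rule ip_mono) (use assms Q_cont *(2) in \<open>auto intro!: continuous_intros simp: mult_ac\<close>)
  moreover have "ip (\<lambda>r. - C * f r) f \<le> ip f (\<lambda>r. Q r * f r)"
    by (rule ip_mono) (use assms Q_cont *(1) in \<open>auto intro!: continuous_intros simp: mult_ac\<close>)
  ultimately show ?thesis unfolding ip_cmult_left by auto
qed

text \<open>Integration by parts turns the energy into -<f, f''>, and f'' = P f - (sum of kappa_j
  c_j e_j). It is applied to the eigenfunctions with P = Q and \<kappa> = lam^2, and to the sines
  with P = 0 and \<kappa> = mu^2.\<close>

lemma energy_combination:
  fixes c :: "'j \<Rightarrow> real"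
  assumes "finite J"
    and e: "\<And>j. j \<in> J \<Longrightarrow> has_X_deriv (e j) (e' j)"
      "\<And>j. j \<in> J \<Longrightarrow> has_X_deriv (e' j) (\<lambda>r. (P r - \<kappa> j) * e j r)"
      "\<And>j. j \<in> J \<Longrightarrow> e j a = 0" "\<And>j. j \<in> J \<Longrightarrow> e j b = 0"
    and P: "continuous_on {a..b} P"
    and orth: "\<And>i j. i \<in> J \<Longrightarrow> j \<in> J \<Longrightarrow> ip (e i) (e j) = (if i = j then 1 else 0)"
  defines "f \<equiv> \<lambda>r. \<Sum>j\<in>J. c j * e j r"
  defines "g \<equiv> \<lambda>r. \<Sum>j\<in>J. c j * e' j r"
  shows "ip g g = (\<Sum>j\<in>J. \<kappa> j * (c j)\<^sup>2) - ip f (\<lambda>r. P r * f r)"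
proof -
  have ec: "\<And>j. j \<in> J \<Longrightarrow> continuous_on {a..b} (e j)" "\<And>j. j \<in> J \<Longrightarrow> continuous_on {a..b} (e' j)"
    using e has_X_deriv_cont by blast+
  have fc: "continuous_on {a..b} f" and gc: "continuous_on {a..b} g"
    unfolding f_def g_def using ec by (auto intro!: continuous_intros)
  have fg: "has_X_deriv f g" unfolding f_def g_def using e by (intro has_X_deriv_sum) auto
  have "has_X_deriv g (\<lambda>r. \<Sum>j\<in>J. c j * ((P r - \<kappa> j) * e j r))"
    unfolding g_def using e by (intro has_X_deriv_sum) auto
  moreover have "(\<lambda>r. \<Sum>j\<in>J. c j * ((P r - \<kappa> j) * e j r))
      = (\<lambda>r. P r * f r - (\<Sum>j\<in>J. (\<kappa> j * c j) * e j r))"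
    by (auto simp: f_def fun_eq_iff sum_distrib_left sum_subtractf[symmetric] algebra_simps)
  ultimately have g': "has_X_deriv g (\<lambda>r. P r * f r - (\<Sum>j\<in>J. (\<kappa> j * c j) * e j r))"
    by simp
  have f0: "f a = 0" "f b = 0" using e by (auto simp: f_def)
  have "ip g g + ip f (\<lambda>r. P r * f r - (\<Sum>j\<in>J. (\<kappa> j * c j) * e j r)) = 0"
  proof -
    have "continuous_on {a..b} (\<lambda>r. P r * f r - (\<Sum>j\<in>J. (\<kappa> j * c j) * e j r))"
      using fc ec P by (intro continuous_intros) auto
    from ip_by_parts[OF fg g' gc this] f0 show ?thesis by simp
  qed
  moreover have "ip f (\<lambda>r. P r * f r - (\<Sum>j\<in>J. (\<kappa> j * c j) * e j r))
      = ip f (\<lambda>r. P r * f r) - ip f (\<lambda>r. \<Sum>j\<in>J. (\<kappa> j * c j) * e j r)"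
  proof -
    have "continuous_on {a..b} (\<lambda>r. P r * f r)" "continuous_on {a..b} (\<lambda>r. \<Sum>j\<in>J. (\<kappa> j * c j) * e j r)"
      using fc ec P by (auto intro!: continuous_intros)
    then show ?thesis using ip_diff_left[of "\<lambda>r. P r * f r" _ f] fc by (simp add: ip_commute[of f])
  qed
  moreover have "ip f (\<lambda>r. \<Sum>j\<in>J. (\<kappa> j * c j) * e j r) = (\<Sum>j\<in>J. (\<kappa> j * c j) * ip f (e j))"
    using assms(1) ec fc by (intro ip_sum_right) auto
  moreover have "\<dots> = (\<Sum>j\<in>J. \<kappa> j * (c j)\<^sup>2)"
    using assms(1) ec orth by (intro sum.cong) (auto simp: f_def orthonormal_coeff power2_eq_square)
  ultimately show ?thesis by simp
qed

end

section \<open>Comparison of the eigenvalues with those of the sines\<close>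

locale liouville_eigenbasis = liouville_interval +
  fixes w v :: "nat \<Rightarrow> real \<Rightarrow> real" and lam :: "nat \<Rightarrow> real"
  assumes w_deriv: "n \<ge> 1 \<Longrightarrow> has_X_deriv (w n) (v n)"
    and v_deriv: "n \<ge> 1 \<Longrightarrow> has_X_deriv (v n) (\<lambda>r. (Q r - (lam n)\<^sup>2) * w n r)"
    and w_a: "n \<ge> 1 \<Longrightarrow> w n a = 0" and w_b: "n \<ge> 1 \<Longrightarrow> w n b = 0"
    and v_a: "n \<ge> 1 \<Longrightarrow> 0 < v n a"
    and w_orthonormal: "m \<ge> 1 \<Longrightarrow> n \<ge> 1 \<Longrightarrow> ip (w m) (w n) = (if m = n then 1 else 0)"
    and lam_pos: "n \<ge> 1 \<Longrightarrow> 0 < lam n"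
    and lam_mono: "1 \<le> m \<Longrightarrow> m \<le> n \<Longrightarrow> (lam m)\<^sup>2 \<le> (lam n)\<^sup>2"
    and w_complete: "continuous_on {a..b} f \<Longrightarrow>
      (\<lambda>N. ip (\<lambda>r. f r - (\<Sum>k=1..N. ip f (w k) * w k r)) (\<lambda>r. f r - (\<Sum>k=1..N. ip f (w k) * w k r)))
        \<longlonglongrightarrow> 0"
begin

lemma w_cont: "n \<ge> 1 \<Longrightarrow> continuous_on {a..b} (w n)"
  using w_deriv has_X_deriv_cont by blast

lemma v_cont: "n \<ge> 1 \<Longrightarrow> continuous_on {a..b} (v n)"
  using v_deriv has_X_deriv_cont by blast

text \<open>Test function: a nonzero combination of the first \<open>n\<close> eigenfunctions that vanishes at the
  \<open>n - 1\<close> interior nodes of \<open>sine n\<close>.\<close>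

lemma eigenvalue_lower_bound:
  assumes n: "n \<ge> 1"
  shows "(mu n)\<^sup>2 - C \<le> (lam n)\<^sup>2"
proof -
  obtain t where t: "\<And>j. j \<le> n \<Longrightarrow> t j \<in> {a..b}" "\<And>j. j \<le> n \<Longrightarrow> X (t j) = len * real j / real n"
    "t 0 = a" "t n = b" using nodes_exist[OF n] by blast
  have "n - 1 < card {1..n}" using n by simp
  \<comment> \<open>Row i stands for the interior node t (i + 1), so there are n - 1 equations for n
    unknowns; at the nodes t 0 and t n the combination vanishes by the boundary conditions.\<close>
  from homogeneous_system_nontrivial[OF _ this, of "\<lambda>i j. w j (t (Suc i))"]
  obtain c where c: "\<exists>j\<in>{1..n}. c j \<noteq> 0" "\<And>i. i < n - 1 \<Longrightarrow> (\<Sum>j\<in>{1..n}. c j * w j (t (Suc i))) = 0"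
    by auto
  define f where "f = (\<lambda>r. \<Sum>j\<in>{1..n}. c j * w j r)"
  define g where "g = (\<lambda>r. \<Sum>j\<in>{1..n}. c j * v j r)"
  have f: "continuous_on {a..b} f" and g: "continuous_on {a..b} g"
    unfolding f_def g_def using w_cont v_cont by (auto intro!: continuous_intros)
  have f0: "f (t j) = 0" if j: "j \<le> n" for j
  proof -
    consider "j = 0" | "j = n" | "j \<noteq> 0" "j < n" using j by linarith
    then show ?thesis
    proof cases
      case 3
      then have "j - 1 < n - 1" "Suc (j - 1) = j" by auto
      with c(2)[of "j - 1"] show ?thesis by (simp add: f_def)
    qed (simp_all add: f_def t w_a w_b)
  qed
  have fg: "has_X_deriv f g" unfolding f_def g_def using w_deriv by (intro has_X_deriv_sum) auto
  have norm: "ip f f = (\<Sum>j\<in>{1..n}. (c j)\<^sup>2)"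
    unfolding f_def by (rule orthonormal_norm) (auto simp: w_cont w_orthonormal)
  obtain k where k: "k \<in> {1..n}" "c k \<noteq> 0" using c(1) by blast
  have "0 < (\<Sum>j\<in>{1..n}. (c j)\<^sup>2)"
    by (rule sum_pos2[of _ k]) (use k in auto)
  then have pos: "0 < ip f f" by (simp add: norm)
  \<comment> \<open>The chain is mu_n^2 |f|^2 \<le> |f'|^2 = (sum of lam_j^2 c_j^2) - <f, Q f> \<le>
    (lam_n^2 + C) |f|^2; the ordering of the eigenvalues enters in the last inequality.\<close>
  have "(mu n)\<^sup>2 * ip f f \<le> ip g g" by (rule nodal_Wirtinger[OF n fg g t f0])
  moreover have "ip g g = (\<Sum>j\<in>{1..n}. (lam j)\<^sup>2 * (c j)\<^sup>2) - ip f (\<lambda>r. Q r * f r)"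
    unfolding f_def g_def
    by (rule energy_combination) (auto simp: w_deriv v_deriv w_a w_b Q_cont w_orthonormal)
  moreover have "(\<Sum>j\<in>{1..n}. (lam j)\<^sup>2 * (c j)\<^sup>2) \<le> (lam n)\<^sup>2 * ip f f"
    unfolding norm sum_distrib_left by (intro sum_mono mult_right_mono lam_mono) auto
  ultimately have "(mu n)\<^sup>2 * ip f f \<le> (lam n)\<^sup>2 * ip f f + C * ip f f"
    using potential_bound[OF f] by linarith
  then have "((mu n)\<^sup>2 - C) * ip f f \<le> (lam n)\<^sup>2 * ip f f" by (simp add: left_diff_distrib)
  then show ?thesis using pos by simp
qed

text \<open>Test function: a nonzero combination of the first \<open>n\<close> sines orthogonal to the first
  \<open>n - 1\<close> eigenfunctions; here the completeness of the eigenfunctions enters.\<close>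

lemma eigenvalue_upper_bound:
  assumes n: "n \<ge> 1"
  shows "(lam n)\<^sup>2 \<le> (mu n)\<^sup>2 + C"
proof -
  have "n - 1 < card {1..n}" using n by simp
  from homogeneous_system_nontrivial[OF _ this, of "\<lambda>i j. ip (sine j) (w (Suc i))"]
  obtain c where c: "\<exists>j\<in>{1..n}. c j \<noteq> 0"
    "\<And>i. i < n - 1 \<Longrightarrow> (\<Sum>j\<in>{1..n}. c j * ip (sine j) (w (Suc i))) = 0"
    by auto
  define f where "f = (\<lambda>r. \<Sum>j\<in>{1..n}. c j * sine j r)"
  define g where "g = (\<lambda>r. \<Sum>j\<in>{1..n}. c j * cosine j r)"
  define g' where "g' = (\<lambda>r. \<Sum>j\<in>{1..n}. c j * (- (mu j)\<^sup>2 * sine j r))"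
  have f: "continuous_on {a..b} f" and g: "continuous_on {a..b} g" and g'c: "continuous_on {a..b} g'"
    unfolding f_def g_def g'_def using sine_cont cosine_cont by (auto intro!: continuous_intros)
  have f0: "f a = 0" "f b = 0" by (auto simp: f_def sine_a sine_b)
  have fg: "has_X_deriv f g" unfolding f_def g_def using sine_X_deriv by (intro has_X_deriv_sum) auto
  have gg': "has_X_deriv g g'" unfolding g'_def g_def using cosine_X_deriv by (intro has_X_deriv_sum) auto
  have norm: "ip f f = (\<Sum>j\<in>{1..n}. (c j)\<^sup>2)"
    unfolding f_def by (rule orthonormal_norm) (auto simp: sine_cont sine_orthonormal)
  obtain k where k: "k \<in> {1..n}" "c k \<noteq> 0" using c(1) by blast
  have "0 < (\<Sum>j\<in>{1..n}. (c j)\<^sup>2)"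
    by (rule sum_pos2[of _ k]) (use k in auto)
  then have pos: "0 < ip f f" by (simp add: norm)
  have "ip g g = (\<Sum>j\<in>{1..n}. (mu j)\<^sup>2 * (c j)\<^sup>2) - ip f (\<lambda>r. 0 * f r)"
    unfolding f_def g_def
    by (rule energy_combination) (use cosine_X_deriv in \<open>auto simp: sine_X_deriv sine_a sine_b sine_orthonormal\<close>)
  also have "\<dots> \<le> (mu n)\<^sup>2 * ip f f"
    unfolding norm sum_distrib_left
    by (auto simp: ip_def intro!: sum_mono mult_right_mono power_mono mu_mono mu_nonneg)
  finally have gg: "ip g g \<le> (mu n)\<^sup>2 * ip f f" .
  \<comment> \<open>\<open>B\<close> is -f'' + Q f - lam_n^2 f, so \<open>ip B f\<close> is the full
    energy of f minus lam_n^2 |f|^2. The aim is that it is nonnegative, since the energy is at most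
    (mu_n^2 + C) |f|^2.\<close>
  define B where "B = (\<lambda>r. (Q r * f r - g' r) - (lam n)\<^sup>2 * f r)"
  have B: "continuous_on {a..b} B"
    unfolding B_def using f g'c Q_cont by (auto intro!: continuous_intros)
  have ip_B: "ip B k = ip (\<lambda>r. Q r * f r) k - ip g' k - (lam n)\<^sup>2 * ip f k"
    if "continuous_on {a..b} k" for k
    unfolding B_def using f g'c Q_cont that
    by (simp add: ip_diff_left ip_cmult_left continuous_intros)
  define d where "d = (\<lambda>k. ip f (w k))"
  have d0: "d k = 0" if "1 \<le> k" "k < n" for k
  proof -
    have "d k = (\<Sum>j\<in>{1..n}. c j * ip (sine j) (w k))"
      unfolding d_def f_def using that by (intro ip_sum_left) (auto simp: sine_cont w_cont)
    then show ?thesis using c(2)[of "k - 1"] that by simp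
  qed
  \<comment> \<open>Two integrations by parts move both derivatives from f onto the eigenfunction;
    all boundary terms vanish.\<close>
  have Bw: "ip B (w k) = ((lam k)\<^sup>2 - (lam n)\<^sup>2) * d k" if k: "k \<ge> 1" for k
  proof -
    have "ip g' (w k) + ip g (v k) = 0"
      using ip_by_parts[OF gg' w_deriv g'c] k by (simp add: v_cont w_a w_b)
    moreover have "ip g (v k) + ip f (\<lambda>r. (Q r - (lam k)\<^sup>2) * w k r) = 0"
      using ip_by_parts[OF fg v_deriv g] k w_cont[OF k] Q_cont f0 by (simp add: continuous_intros)
    moreover have "ip f (\<lambda>r. (Q r - (lam k)\<^sup>2) * w k r) = ip (\<lambda>r. Q r * f r) (w k) - (lam k)\<^sup>2 * d k"
    proof -
      have "ip f (\<lambda>r. (Q r - (lam k)\<^sup>2) * w k r) = ip (\<lambda>r. Q r * f r - (lam k)\<^sup>2 * f r) (w k)"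
        by (simp add: ip_def algebra_simps)
      then show ?thesis using f Q_cont w_cont[OF k]
        by (simp add: ip_diff_left ip_cmult_left continuous_intros d_def)
    qed
    ultimately show ?thesis
      unfolding ip_B[OF w_cont[OF k]] d_def left_diff_distrib by linarith
  qed
  define S where "S = (\<lambda>N r. \<Sum>k=1..N. d k * w k r)"
  have S: "continuous_on {a..b} (S N)" for N
    unfolding S_def using w_cont by (auto intro!: continuous_intros)
  \<comment> \<open>No summand is negative: for k < n the coefficient d k is 0 by the choice of f,
    and for k \<ge> n the factor lam_k^2 - lam_n^2 is nonnegative.\<close>
  have BS: "0 \<le> ip B (S N)" for N
  proof -
    have "ip B (S N) = (\<Sum>k=1..N. d k * ip B (w k))"
      unfolding S_def using B w_cont by (intro ip_sum_right) auto
    also have "\<dots> = (\<Sum>k=1..N. ((lam k)\<^sup>2 - (lam n)\<^sup>2) * (d k)\<^sup>2)"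
      by (intro sum.cong) (auto simp: Bw power2_eq_square)
    also have "0 \<le> \<dots>"
    proof (intro sum_nonneg)
      fix k assume "k \<in> {1..N}"
      then show "0 \<le> ((lam k)\<^sup>2 - (lam n)\<^sup>2) * (d k)\<^sup>2"
        using d0[of k] lam_mono[of n k] n by (cases "k < n") auto
    qed
    finally show ?thesis .
  qed
  \<comment> \<open>Mean convergence of \<open>S N\<close> to f is enough, because B is a fixed
    function and Cauchy-Schwarz applies; the derivatives of the expansion never have to
    converge.\<close>
  have "(\<lambda>N. ip B (\<lambda>r. f r - S N r)) \<longlonglongrightarrow> 0"
  proof -
    have "(\<lambda>N. ip B B * ip (\<lambda>r. f r - S N r) (\<lambda>r. f r - S N r)) \<longlonglongrightarrow> ip B B * 0"
      unfolding S_def d_def by (intro tendsto_mult tendsto_const w_complete f)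
    then have "(\<lambda>N. (ip B (\<lambda>r. f r - S N r))\<^sup>2) \<longlonglongrightarrow> 0"
      by (intro tendsto_sandwich[OF _ _ tendsto_const, of 0 "\<lambda>N. (ip B (\<lambda>r. f r - S N r))\<^sup>2"])
        (auto intro!: always_eventually ip_Cauchy_Schwarz B continuous_intros f S)
    then have "(\<lambda>N. sqrt ((ip B (\<lambda>r. f r - S N r))\<^sup>2)) \<longlonglongrightarrow> sqrt 0" by (rule tendsto_real_sqrt)
    then show ?thesis by (simp add: tendsto_rabs_zero_iff)
  qed
  moreover have "ip B (\<lambda>r. f r - S N r) \<le> ip B f" for N
    using BS[of N] ip_diff_left[OF f S B, of N] by (simp add: ip_commute)
  ultimately have "0 \<le> ip B f"
    by (intro tendsto_upperbound[of _ 0 sequentially]) auto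
  also have "ip B f = ip f (\<lambda>r. Q r * f r) - ip g' f - (lam n)\<^sup>2 * ip f f"
    by (simp add: ip_B f ip_commute)
  also have "ip g' f = - ip g g"
    using ip_by_parts[OF gg' fg g'c g] f0 by simp
  finally have "(lam n)\<^sup>2 * ip f f \<le> ((mu n)\<^sup>2 + C) * ip f f"
    using gg potential_bound[OF f] by (simp add: distrib_right)
  then show ?thesis using pos by simp
qed

section \<open>Variation of constants and uniform asymptotics of the eigenfunctions\<close>

lemma C_nonneg: "0 \<le> C"
  using Q_bound[of a] ab by (auto intro: order_trans[OF abs_ge_zero])

text \<open>With x fixed, the function \<open>G\<close> of r interpolates between the two terms on
  the left: its value at r = x is lam w(x), its value at r = a is v(a) sin(lam X(x)). In its
  X-derivative every term except the one with Q cancels.\<close>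

lemma variation_of_constants:
  assumes n: "n \<ge> 1" and x: "x \<in> {a..b}"
  shows "lam n * w n x - v n a * sin (lam n * X x)
    = integral {a..x} (\<lambda>r. Q r * w n r * sin (lam n * (X x - X r)) * h r)"
proof -
  define G where "G = (\<lambda>r. lam n * w n r * cos (lam n * (X x - X r)) + v n r * sin (lam n * (X x - X r)))"
  have "has_X_deriv G (\<lambda>r. Q r * w n r * sin (lam n * (X x - X r)))"
    unfolding has_X_deriv_def
  proof
    fix r assume r: "r \<in> {a..b}"
    have "(w n has_real_derivative v n r * h r) (at r within {a..b})"
      "(v n has_real_derivative (Q r - (lam n)\<^sup>2) * w n r * h r) (at r within {a..b})"
      using w_deriv[OF n] v_deriv[OF n] r unfolding has_X_deriv_def by auto
    then show "(G has_real_derivative Q r * w n r * sin (lam n * (X x - X r)) * h r) (at r within {a..b})"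
      unfolding G_def
      by (auto intro!: derivative_eq_intros X_deriv r simp: algebra_simps power2_eq_square)
  qed
  from X_deriv_integral[OF this, of a x] x show ?thesis
    by (simp add: integral_unique G_def w_a[OF n] X_a)
qed

text \<open>The integral in \<open>variation_of_constants\<close> is at most C times the weighted
  L^1 norm of w, and Cauchy-Schwarz against the constant 1 bounds that norm by sqrt len because w
  has norm 1.\<close>

lemma eigenfunction_phase_bound:
  assumes n: "n \<ge> 1" and x: "x \<in> {a..b}"
  shows "\<bar>w n x - v n a / lam n * sin (lam n * X x)\<bar> \<le> C * sqrt len / lam n"
proof -
  have absw: "continuous_on {a..b} (\<lambda>r. \<bar>w n r\<bar>)" using w_cont[OF n] by (intro continuous_intros)
  have "ip (\<lambda>r. \<bar>w n r\<bar>) (\<lambda>r. \<bar>w n r\<bar>) = 1"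
    using w_orthonormal[OF n n] by (simp add: ip_def)
  then have "(ip (\<lambda>r. \<bar>w n r\<bar>) (\<lambda>_. 1))\<^sup>2 \<le> len"
    using ip_Cauchy_Schwarz[OF absw, of "\<lambda>_. 1"] ip_const[of 1 1] by simp
  then have L1: "ip (\<lambda>r. \<bar>w n r\<bar>) (\<lambda>_. 1) \<le> sqrt len" by (rule real_le_rsqrt)
  have int: "(\<lambda>r. C * (\<bar>w n r\<bar> * 1 * h r)) integrable_on {a..b}"
    using absw by (intro integrable_on_mult_right ip_integrable) auto
  have sub: "{a..x} \<subseteq> {a..b}" using x by auto
  note cont = continuous_on_subset[OF _ sub]
  have "\<bar>integral {a..x} (\<lambda>r. Q r * w n r * sin (lam n * (X x - X r)) * h r)\<bar>
      \<le> integral {a..x} (\<lambda>r. C * (\<bar>w n r\<bar> * 1 * h r))"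
    unfolding real_norm_def[symmetric]
  proof (rule integral_norm_bound_integral)
    show "(\<lambda>r. Q r * w n r * sin (lam n * (X x - X r)) * h r) integrable_on {a..x}"
      using cont[OF Q_cont] cont[OF w_cont[OF n]] cont[OF X_cont] cont[OF h_cont]
      by (intro integrable_continuous_real continuous_intros)
    show "(\<lambda>r. C * (norm (w n r) * 1 * h r)) integrable_on {a..x}"
      using integrable_subinterval_real[OF int sub] by simp
    fix r assume "r \<in> {a..x}"
    then have r: "r \<in> {a..b}" using sub by auto
    have "\<bar>Q r\<bar> * \<bar>w n r\<bar> * \<bar>sin (lam n * (X x - X r))\<bar> * h r \<le> C * \<bar>w n r\<bar> * 1 * h r"
      using Q_bound[OF r] h_pos[OF r] C_nonneg by (intro mult_mono mult_nonneg_nonneg) auto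
    then show "norm (Q r * w n r * sin (lam n * (X x - X r)) * h r) \<le> C * (norm (w n r) * 1 * h r)"
      using h_pos[OF r] by (simp add: abs_mult mult_ac)
  qed
  also have "\<dots> \<le> integral {a..b} (\<lambda>r. C * (\<bar>w n r\<bar> * 1 * h r))"
    using C_nonneg h_pos by (intro integral_subset_le sub int integrable_subinterval_real[OF int sub])
      (auto intro!: mult_nonneg_nonneg simp: less_imp_le)
  also have "\<dots> = C * ip (\<lambda>r. \<bar>w n r\<bar>) (\<lambda>_. 1)" by (simp add: ip_def)
  also have "\<dots> \<le> C * sqrt len" using L1 C_nonneg by (rule mult_left_mono)
  finally have "\<bar>lam n * w n x - v n a * sin (lam n * X x)\<bar> \<le> C * sqrt len"
    by (simp add: variation_of_constants[OF n x])
  also have "lam n * w n x - v n a * sin (lam n * X x) = lam n * (w n x - v n a / lam n * sin (lam n * X x))"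
    using lam_pos[OF n] by (simp add: field_simps)
  finally have "lam n * \<bar>w n x - v n a / lam n * sin (lam n * X x)\<bar> \<le> C * sqrt len"
    using lam_pos[OF n] by (simp add: abs_mult)
  then show ?thesis using lam_pos[OF n] by (simp add: pos_le_divide_eq mult.commute)
qed

text \<open>The squares differ by at most C; divide by lam_n + mu_n, which exceeds mu_n = pi n /
  len.\<close>

lemma eigenvalue_asymptotics:
  assumes n: "n \<ge> 1"
  shows "\<bar>lam n - mu n\<bar> \<le> C * len / pi / real n"
proof -
  have mu: "0 < mu n" using n len_pos by (simp add: mu_def)
  have "\<bar>lam n - mu n\<bar> * mu n \<le> \<bar>lam n - mu n\<bar> * (lam n + mu n)"
    using lam_pos[OF n] by (intro mult_left_mono) auto
  also have "\<dots> = \<bar>(lam n)\<^sup>2 - (mu n)\<^sup>2\<bar>"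
    using lam_pos[OF n] mu by (simp add: power2_eq_square square_diff_square_factored abs_mult mult.commute)
  also have "\<dots> \<le> C" using eigenvalue_lower_bound[OF n] eigenvalue_upper_bound[OF n] by auto
  finally have "\<bar>lam n - mu n\<bar> \<le> C / mu n" using mu by (simp add: pos_le_divide_eq)
  also have "\<dots> = C * len / pi / real n" by (simp add: mu_def)
  finally show ?thesis .
qed

theorem eigenfunction_asymptotics:
  obtains K N where "0 \<le> K" "1 \<le> N"
    "\<And>n r. n \<ge> N \<Longrightarrow> r \<in> {a..b} \<Longrightarrow> \<bar>w n r - sine n r\<bar> \<le> K / real n"
proof -
  \<comment> \<open>Each constant is n times an error bound, except \<open>M\<close>, which bounds
    the amplitude D. \<open>K1\<close> is for the phase error, \<open>K2\<close> for the integral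
    term divided by lam (its factor 2 comes from lam \<ge> mu / 2), and \<open>K3\<close> for w - D
    sine. The last summand of \<open>K\<close> pays for replacing D by 1.\<close>
  define K1 where "K1 = C * len / pi * len"
  define K2 where "K2 = 2 * C * sqrt len * len / pi"
  define M where "M = 2 + 2 * sqrt len * K2"
  define \<sigma> where "\<sigma> = sqrt (2 / len)"
  define K3 where "K3 = K2 + M * \<sigma> * K1"
  define K where "K = K3 + sqrt len * K3 * \<sigma>"
  have nonneg: "0 \<le> K1" "0 \<le> K2" "0 \<le> \<sigma>" "0 \<le> M"
    using C_nonneg len_pos by (auto simp: K1_def K2_def \<sigma>_def M_def)
  then have K3: "0 \<le> K3" by (simp add: K3_def)
  have slen: "0 < sqrt len" "sqrt len * sqrt len = len" "0 < \<sigma>" using len_pos by (auto simp: \<sigma>_def)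
  \<comment> \<open>The first entry forces lam \<ge> mu / 2; the second makes K1 / n at most 1/4,
    for the absorption that bounds D.\<close>
  obtain N1 :: nat where N1: "max (4 * C * len * len / (pi * pi)) (4 * K1) \<le> real N1"
    using real_arch_simple by blast
  define N where "N = max 1 N1"
  have "\<bar>w n r - sine n r\<bar> \<le> K / real n" if nN: "n \<ge> N" and r: "r \<in> {a..b}" for n r
  proof -
    have n: "n \<ge> 1" using nN by (simp add: N_def)
    then have n0: "0 < real n" by simp
    have big: "4 * C * len * len / (pi * pi) \<le> real n" "4 * K1 \<le> real n"
      using N1 nN unfolding N_def by (meson max.bounded_iff of_nat_mono order_trans)+
    have mu: "0 < mu n" using n len_pos by (simp add: mu_def)
    have "C * len / pi / real n \<le> mu n / 2"
    proof -
      have "2 * C * len * len \<le> pi * pi * (real n * 1)"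
      proof -
        have "4 * C * len * len \<le> real n * (pi * pi)"
          using big(1) by (simp add: pos_divide_le_eq)
        moreover have "0 \<le> C * len * len" using C_nonneg len_pos by simp
        ultimately show ?thesis by (simp add: mult_ac)
      qed
      also have "\<dots> \<le> pi * pi * (real n * real n)" using n by (intro mult_left_mono) auto
      finally show ?thesis using len_pos n0 by (simp add: mu_def field_simps)
    qed
    then have lam_half: "mu n / 2 \<le> lam n" using eigenvalue_asymptotics[OF n] by linarith
    have eps: "C * sqrt len / lam n \<le> K2 / real n"
    proof -
      have "C * sqrt len / lam n \<le> C * sqrt len / (mu n / 2)"
        using lam_half mu C_nonneg len_pos by (intro divide_left_mono) (auto simp: lam_pos[OF n])
      then show ?thesis by (simp add: mu_def K2_def mult_ac)
    qed
    \<comment> \<open>\<open>A\<close> is the amplitude left by variation of constants, positive by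
      \<open>v_a\<close>; \<open>D\<close> is its ratio to the amplitude \<sigma> of the normalised
      sine.\<close>
    define A where "A = v n a / lam n"
    define D where "D = A / \<sigma>"
    have A: "0 < A" and D: "0 < D" and AD: "A = D * \<sigma>"
      using v_a[OF n] lam_pos[OF n] slen by (auto simp: A_def D_def)
    have phase: "\<bar>sin (lam n * X s) - sin (mu n * X s)\<bar> \<le> K1 / real n" if "s \<in> {a..b}" for s
    proof -
      have "\<bar>sin (lam n * X s) - sin (mu n * X s)\<bar> \<le> \<bar>lam n - mu n\<bar> * \<bar>X s\<bar>"
        using abs_sin_diff_le[of "lam n * X s" "mu n * X s"]
        by (simp add: left_diff_distrib[symmetric] abs_mult)
      also have "\<dots> \<le> C * len / pi / real n * len"
        using eigenvalue_asymptotics[OF n] X_range[OF that] by (intro mult_mono) auto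
      finally show ?thesis by (simp add: K1_def)
    qed
    define \<eta> where "\<eta> = K2 / real n + A * (K1 / real n)"
    have near: "\<bar>w n s - D * sine n s\<bar> \<le> \<eta>" if s: "s \<in> {a..b}" for s
    proof -
      have "w n s - D * sine n s = (w n s - A * sin (lam n * X s)) + A * (sin (lam n * X s) - sin (mu n * X s))"
        by (simp add: sine_def AD \<sigma>_def algebra_simps)
      moreover have "\<bar>A * (sin (lam n * X s) - sin (mu n * X s))\<bar> \<le> A * (K1 / real n)"
        using A mult_left_mono[OF phase[OF s], of A] by (simp add: abs_mult)
      ultimately show ?thesis
        using eigenfunction_phase_bound[OF n s] eps unfolding \<eta>_def A_def by linarith
    qed
    have eta0: "0 \<le> \<eta>" using nonneg A by (simp add: \<eta>_def)
    \<comment> \<open>Since D > 0 and w and sine are unit vectors, this is the reverse triangle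
      inequality |1 - D| \<le> |w - D sine|, followed by the uniform bound \<eta> on an interval of
      X-length \<open>len\<close>.\<close>
    have D1: "\<bar>1 - D\<bar> \<le> sqrt len * \<eta>"
    proof -
      define e where "e = (\<lambda>r. w n r - D * sine n r)"
      note c = w_cont[OF n] sine_cont[of n]
      have e: "continuous_on {a..b} e" unfolding e_def using c by (intro continuous_intros)
      have ws: "ip (w n) (sine n) \<le> 1"
        using ip_Cauchy_Schwarz[OF c] w_orthonormal[OF n n] sine_orthonormal[OF n n]
        by (simp add: abs_square_le_1)
      have "ip e e = ip (w n) e - D * ip (sine n) e"
        unfolding e_def using c by (subst ip_diff_left) (auto intro!: continuous_intros simp: ip_cmult_left)
      also have "ip (w n) e = 1 - D * ip (w n) (sine n)"
        unfolding e_def using c w_orthonormal[OF n n]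
        by (subst ip_commute, subst ip_diff_left)
          (auto intro!: continuous_intros simp: ip_cmult_left ip_commute[of "sine n" "w n"])
      also have "ip (sine n) e = ip (w n) (sine n) - D"
        unfolding e_def using c sine_orthonormal[OF n n]
        by (subst ip_commute, subst ip_diff_left) (auto intro!: continuous_intros simp: ip_cmult_left)
      finally have "ip e e = 1 - 2 * D * ip (w n) (sine n) + D\<^sup>2"
        by (simp add: algebra_simps power2_eq_square)
      moreover have "D * ip (w n) (sine n) \<le> D * 1" using ws D by (intro mult_left_mono) auto
      ultimately have "(1 - D)\<^sup>2 \<le> ip e e" by (simp add: power2_eq_square algebra_simps)
      also have "\<dots> \<le> ip (\<lambda>_. \<eta>) (\<lambda>_. \<eta>)"
      proof (rule ip_mono)
        fix s assume "s \<in> {a..b}"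
        then have "\<bar>e s\<bar> * \<bar>e s\<bar> \<le> \<eta> * \<eta>" using near[of s] by (intro mult_mono) (auto simp: e_def)
        then show "e s * e s \<le> \<eta> * \<eta>" by simp
      qed (use e in auto)
      also have "\<dots> = (sqrt len * \<eta>)\<^sup>2"
        using len_pos by (simp add: ip_const power_mult_distrib power2_eq_square[of \<eta>])
      finally have "\<bar>1 - D\<bar> \<le> \<bar>sqrt len * \<eta>\<bar>" by (simp only: abs_le_square_iff)
      then show ?thesis using eta0 len_pos by simp
    qed
    have sls: "sqrt len * \<sigma> = sqrt 2" using len_pos by (simp add: \<sigma>_def flip: real_sqrt_mult)
    \<comment> \<open>\<eta> contains D through A, so \<open>D1\<close> bounds D in terms of itself.
      As sqrt len * \<sigma> = sqrt 2 and K1 / n \<le> 1/4, that part is at most D / 2 and moves to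
      the left side.\<close>
    have DM: "D \<le> M"
    proof -
      have "sqrt 2 \<le> (2::real)" by (rule real_le_lsqrt) auto
      then have "sqrt 2 * (K1 / real n) \<le> 2 * (K1 / real n)"
        using nonneg by (intro mult_right_mono) auto
      also have "\<dots> \<le> 1 / 2" using big(2) n0 by (simp add: field_simps)
      finally have half: "D * (sqrt 2 * (K1 / real n)) \<le> D * (1 / 2)" using D by (intro mult_left_mono) auto
      have "K2 / real n \<le> K2" using nonneg n by (simp add: divide_le_eq mult_left_le mult_le_cancel_left1)
      then have "sqrt len * (K2 / real n) \<le> sqrt len * K2" using slen by (intro mult_left_mono) auto
      moreover have "sqrt len * \<eta> = sqrt len * (K2 / real n) + D * (sqrt 2 * (K1 / real n))"
        unfolding \<eta>_def AD sls[symmetric] by (simp only: algebra_simps)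
      ultimately have "D \<le> 1 + sqrt len * K2 + D * (1 / 2)" using D1 half by linarith
      then show ?thesis by (simp add: M_def)
    qed
    have eta: "\<eta> \<le> K3 / real n"
    proof -
      have "D * \<sigma> * (K1 / real n) \<le> M * \<sigma> * (K1 / real n)"
        using DM nonneg by (intro mult_right_mono) auto
      then show ?thesis by (simp add: \<eta>_def AD K3_def add_divide_distrib)
    qed
    have "\<bar>(D - 1) * sine n r\<bar> \<le> sqrt len * (K3 / real n) * \<sigma>"
    proof -
      have "sqrt len * \<eta> \<le> sqrt len * (K3 / real n)" using eta slen by (intro mult_left_mono) auto
      then have "\<bar>D - 1\<bar> \<le> sqrt len * (K3 / real n)" using D1 by linarith
      then show ?thesis unfolding abs_mult
        using abs_sine_le[of n r] by (intro mult_mono) (auto simp: \<sigma>_def)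
    qed
    moreover have "w n r - sine n r = (w n r - D * sine n r) + (D - 1) * sine n r"
      by (simp add: algebra_simps)
    moreover have "K / real n = K3 / real n + sqrt len * (K3 / real n) * \<sigma>"
      by (simp add: K_def add_divide_distrib)
    ultimately show ?thesis using near[OF r] eta by linarith
  qed
  moreover have "0 \<le> K" using K3 nonneg len_pos by (simp add: K_def)
  ultimately show ?thesis using that[of K N] by (auto simp: N_def)
qed

end

section \<open>The Liouville transform of the problem\<close>

locale dispersive_medium =
  fixes r0 r1 r2 :: real
  assumes radii: "0 < r0" "r0 < r1" "r1 < r2"
begin

definition prho :: "real \<Rightarrow> real" where "prho r = 1 / r0\<^sup>2 - 1 / r\<^sup>2"

definition amp :: "real \<Rightarrow> real" where "amp r = prho r powr (- (1/4))"

text \<open>This is p amp', the quasi-derivative of the amplitude; \<open>flux'\<close> is its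
  derivative.\<close>

definition flux :: "real \<Rightarrow> real" where "flux r = - (1/2) * prho r powr (- (5/4)) / r ^ 4"

definition flux' :: "real \<Rightarrow> real"
  where "flux' r = (5/4) * prho r powr (- (9/4)) / r ^ 7 + 2 * prho r powr (- (5/4)) / r ^ 5"

definition speed :: "real \<Rightarrow> real" where "speed r = sqrt (r\<^sup>2 / r0\<^sup>2 - 1)"

text \<open>Q = -(p amp')' amp / X', the term left over when R = amp w is put into the equation and
  the result is divided by X' = \<open>speed\<close>.\<close>

definition potential :: "real \<Rightarrow> real" where "potential r = - flux' r * amp r / speed r"

lemma r_pos: "r \<in> {r1..r2} \<Longrightarrow> 0 < r" "r \<in> {r1..r2} \<Longrightarrow> r0 < r"
  using radii by auto

lemma prho_pos: "r \<in> {r1..r2} \<Longrightarrow> 0 < prho r"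
proof -
  assume "r \<in> {r1..r2}"
  then have "r0\<^sup>2 < r\<^sup>2" using r_pos(2) radii by (intro power_strict_mono) auto
  then show ?thesis using radii by (simp add: prho_def frac_less2)
qed

lemma p_coeff_rho: "r \<in> {r1..r2} \<Longrightarrow> p_coeff r * rho r0 r = prho r"
  using r_pos[of r] radii by (simp add: p_coeff_def rho_def prho_def diff_divide_distrib power2_eq_square)

lemma amp_pos: "r \<in> {r1..r2} \<Longrightarrow> 0 < amp r"
  using prho_pos[of r] by (simp add: amp_def)

lemma amp_square:
  assumes "r \<in> {r1..r2}"
  shows "amp r * amp r * sqrt (prho r) = 1"
  using prho_pos[OF assms]
  unfolding amp_def powr_half_sqrt[OF less_imp_le[OF prho_pos[OF assms]], symmetric] powr_add[symmetric]
  by simp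

lemma speed_eq: "r \<in> {r1..r2} \<Longrightarrow> speed r = r * sqrt (prho r)"
proof -
  assume r: "r \<in> {r1..r2}"
  have "r\<^sup>2 / r0\<^sup>2 - 1 = r\<^sup>2 * prho r"
    using r_pos[OF r] radii by (simp add: prho_def right_diff_distrib)
  then show ?thesis using r_pos[OF r] by (simp add: speed_def real_sqrt_mult)
qed

lemma speed_pos: "r \<in> {r1..r2} \<Longrightarrow> 0 < speed r"
  using r_pos[of r] prho_pos[of r] by (simp add: speed_eq)

text \<open>This says p amp^2 X' = 1, and \<open>amp_rho\<close> says rho amp^2 = X'. The two
  conditions force amp = (p rho)^(-1/4) and X' = sqrt (rho / p). The first gives the X-derivative of
  w a simple form, the second turns the weight rho for R into the weight X' for w.\<close>

lemma amp_speed: "r \<in> {r1..r2} \<Longrightarrow> amp r * amp r * speed r = r"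
  using amp_square[of r] by (simp add: speed_eq)

lemma amp_rho: "r \<in> {r1..r2} \<Longrightarrow> amp r * amp r * rho r0 r = speed r"
proof -
  assume r: "r \<in> {r1..r2}"
  have "rho r0 r = r * prho r" using p_coeff_rho[OF r] r_pos[OF r] by (simp add: p_coeff_def field_simps)
  then have "amp r * amp r * rho r0 r = (amp r * amp r * sqrt (prho r)) * (r * sqrt (prho r))"
    using prho_pos[OF r] by simp
  then show ?thesis using amp_square[OF r] speed_eq[OF r] by simp
qed

lemma prho_deriv:
  assumes r: "r \<in> {r1..r2}"
  shows "(prho has_real_derivative 2 / r ^ 3) (at r)"
proof -
  have "(prho has_real_derivative 0 - (0 * r\<^sup>2 - 1 * (2 * r)) / (r\<^sup>2 * r\<^sup>2)) (at r)"
    unfolding prho_def using r_pos[OF r]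
    by (intro DERIV_diff DERIV_divide DERIV_const) (auto intro!: derivative_eq_intros)
  also have "0 - (0 * r\<^sup>2 - 1 * (2 * r)) / (r\<^sup>2 * r\<^sup>2) = 2 / r ^ 3"
    using r_pos[OF r] by (simp add: power2_eq_square power3_eq_cube)
  finally show ?thesis .
qed

lemma prho_powr_deriv:
  assumes r: "r \<in> {r1..r2}"
  shows "((\<lambda>r. prho r powr s) has_real_derivative s * prho r powr (s - 1) * (2 / r ^ 3)) (at r)"
  using DERIV_fun_powr[OF prho_deriv[OF r] prho_pos[OF r], of s] by simp

lemma amp_deriv:
  assumes r: "r \<in> {r1..r2}"
  shows "(amp has_real_derivative r * flux r) (at r)"
proof -
  have "r * (- (1/2) * x / r ^ 4) = - (1/4) * x * (2 / r ^ 3)" for x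
    using r_pos[OF r] by (simp add: eval_nat_numeral)
  then show ?thesis
    using prho_powr_deriv[OF r, of "- (1/4)"] by (simp add: amp_def[abs_def] flux_def)
qed

lemma flux_deriv:
  assumes r: "r \<in> {r1..r2}"
  shows "(flux has_real_derivative flux' r) (at r)"
proof -
  define x where "x = prho r powr (- (9/4))"
  define y where "y = prho r powr (- (5/4))"
  have r0: "r \<noteq> 0" using r_pos[OF r] by simp
  have d: "((\<lambda>r. prho r powr (- (5/4))) has_real_derivative - (5/4) * x * (2 / r ^ 3)) (at r)"
    using prho_powr_deriv[OF r, of "- (5/4)"] by (simp add: x_def)
  have "(flux has_real_derivative
      (- (1/2) * (- (5/4) * x * (2 / r ^ 3)) * r ^ 4 - - (1/2) * y * (4 * r ^ 3)) / (r ^ 4 * r ^ 4)) (at r)"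
    unfolding flux_def y_def using r0
    by (intro DERIV_divide DERIV_cmult d) (auto intro!: derivative_eq_intros)
  also have "(- (1/2) * (- (5/4) * x * (2 / r ^ 3)) * r ^ 4 - - (1/2) * y * (4 * r ^ 3)) / (r ^ 4 * r ^ 4)
      = (5/4) * x / r ^ 7 + 2 * y / r ^ 5"
    using r0 by (simp add: field_simps eval_nat_numeral)
  finally show ?thesis by (simp only: flux'_def x_def y_def)
qed

lemma cont_of_deriv: "(\<And>r. r \<in> {r1..r2} \<Longrightarrow> (f has_real_derivative f' r) (at r)) \<Longrightarrow> continuous_on {r1..r2} f"
  by (meson DERIV_isCont continuous_at_imp_continuous_on)

lemma prho_cont: "continuous_on {r1..r2} prho" using prho_deriv by (rule cont_of_deriv)

lemma amp_cont: "continuous_on {r1..r2} amp" using amp_deriv by (rule cont_of_deriv)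

lemma speed_cont: "continuous_on {r1..r2} speed"
  unfolding speed_def using radii by (auto intro!: continuous_intros)

lemma rho_cont: "continuous_on {r1..r2} (rho r0)"
  unfolding rho_def using r_pos radii by (auto intro!: continuous_intros)

lemma potential_cont: "continuous_on {r1..r2} potential"
proof -
  have "continuous_on {r1..r2} flux'"
    unfolding flux'_def using prho_cont prho_pos r_pos
    by (intro continuous_intros) (force simp: less_le)+
  then show ?thesis unfolding potential_def using amp_cont speed_cont speed_pos
    by (intro continuous_intros) (force simp: less_le)+
qed

sublocale liouville_interval r1 r2 "xi r0 r1" speed potential "SUP r\<in>{r1..r2}. \<bar>potential r\<bar>"
proof
  show "xi r0 r1 r1 = 0" by (simp add: xi_def)
  fix r assume r: "r \<in> {r1..r2}"
  have "xi r0 r1 = (\<lambda>r. integral {r1..r} speed)" by (simp only: xi_def[abs_def] speed_def[abs_def])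
  then show "(xi r0 r1 has_real_derivative speed r) (at r within {r1..r2})"
    using integral_has_real_derivative[OF speed_cont r] by simp
  have "compact ((\<lambda>r. \<bar>potential r\<bar>) ` {r1..r2})"
    using potential_cont by (intro compact_continuous_image continuous_intros) auto
  then have "bdd_above ((\<lambda>r. \<bar>potential r\<bar>) ` {r1..r2})"
    by (simp add: bounded_imp_bdd_above compact_imp_bounded)
  then show "\<bar>potential r\<bar> \<le> (SUP r\<in>{r1..r2}. \<bar>potential r\<bar>)"
    using r by (rule cSUP_upper2) auto
qed (use radii speed_cont speed_pos potential_cont in auto)

lemma R_LG_eq: "r \<in> {r1..r2} \<Longrightarrow> R_LG r0 r1 r2 m r = amp r * sine m r"
  using p_coeff_rho[of r]
  by (simp add: R_LG_def Let_def sine_def mu_def len_def amp_def powr_minus_divide)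

section \<open>Passage between the complex weighted inner product and \<open>ip\<close>\<close>

lemma inner_rho_eq:
  assumes F: "continuous_on {r1..r2} F" and g: "continuous_on {r1..r2} g"
    and G: "\<And>r. r \<in> {r1..r2} \<Longrightarrow> G r = complex_of_real (amp r * g r)"
  shows "inner_rho r0 r1 r2 F G = Complex (ip (\<lambda>r. Re (F r) / amp r) g) (ip (\<lambda>r. Im (F r) / amp r) g)"
proof -
  define I where "I = (\<lambda>r. F r * complex_of_real (amp r * g r * rho r0 r))"
  have I: "continuous_on {r1..r2} I"
    unfolding I_def using F g amp_cont rho_cont by (intro continuous_intros)
  have "inner_rho r0 r1 r2 F G = (LINT r|lebesgue_on {r1..r2}. I r)"
    unfolding inner_rho_def I_def by (intro Bochner_Integration.integral_cong) (auto simp: G)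
  also have "\<dots> = integral {r1..r2} I"
    using continuous_imp_integrable_real[OF I] by (intro lebesgue_integral_eq_integral) auto
  finally have eq: "inner_rho r0 r1 r2 F G = integral {r1..r2} I" .
  have int: "I integrable_on {r1..r2}" using I by (rule integrable_continuous_real)
  \<comment> \<open>One factor amp comes with G; the 1 / amp left over after \<open>amp_rho\<close>
    is attached to F.\<close>
  have weight: "amp r * rho r0 r = speed r / amp r" if "r \<in> {r1..r2}" for r
    using amp_rho[OF that] amp_pos[OF that] by (simp add: field_simps)
  have "Re (integral {r1..r2} I) = integral {r1..r2} (\<lambda>r. Re (I r))"
    using integral_linear[OF int bounded_linear_Re] by (simp add: o_def)
  also have "\<dots> = ip (\<lambda>r. Re (F r) / amp r) g"
    unfolding ip_def
  proof (rule Henstock_Kurzweil_Integration.integral_cong)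
    fix r assume r: "r \<in> {r1..r2}"
    have "Re (I r) = Re (F r) * g r * (amp r * rho r0 r)" by (simp add: I_def mult_ac)
    then show "Re (I r) = Re (F r) / amp r * g r * speed r" by (simp add: weight[OF r])
  qed
  finally have re: "Re (integral {r1..r2} I) = ip (\<lambda>r. Re (F r) / amp r) g" .
  have "Im (integral {r1..r2} I) = integral {r1..r2} (\<lambda>r. Im (I r))"
    using integral_linear[OF int bounded_linear_Im] by (simp add: o_def)
  also have "\<dots> = ip (\<lambda>r. Im (F r) / amp r) g"
    unfolding ip_def
  proof (rule Henstock_Kurzweil_Integration.integral_cong)
    fix r assume r: "r \<in> {r1..r2}"
    have "Im (I r) = Im (F r) * g r * (amp r * rho r0 r)" by (simp add: I_def mult_ac)
    then show "Im (I r) = Im (F r) / amp r * g r * speed r" by (simp add: weight[OF r])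
  qed
  finally show ?thesis using re by (simp add: eq complex_eq_iff)
qed

lemma ip_cong: "(\<And>r. r \<in> {r1..r2} \<Longrightarrow> f r = f' r) \<Longrightarrow> (\<And>r. r \<in> {r1..r2} \<Longrightarrow> g r = g' r) \<Longrightarrow> ip f g = ip f' g'"
  unfolding ip_def by (intro Henstock_Kurzweil_Integration.integral_cong) simp

lemma inner_rho_real:
  assumes "continuous_on {r1..r2} f" "continuous_on {r1..r2} g"
    and F: "\<And>r. r \<in> {r1..r2} \<Longrightarrow> F r = complex_of_real (amp r * f r)"
    and G: "\<And>r. r \<in> {r1..r2} \<Longrightarrow> G r = complex_of_real (amp r * g r)"
  shows "inner_rho r0 r1 r2 F G = complex_of_real (ip f g)"
proof -
  have "continuous_on {r1..r2} (\<lambda>r. complex_of_real (amp r * f r))"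
    using assms amp_cont by (intro continuous_intros)
  then have "continuous_on {r1..r2} F" by (rule continuous_on_eq) (simp add: F)
  then have "inner_rho r0 r1 r2 F G = Complex (ip (\<lambda>r. Re (F r) / amp r) g) (ip (\<lambda>r. Im (F r) / amp r) g)"
    using assms by (intro inner_rho_eq)
  also have "ip (\<lambda>r. Re (F r) / amp r) g = ip f g"
  proof (rule ip_cong)
    fix r assume "r \<in> {r1..r2}"
    then show "Re (F r) / amp r = f r" using F[of r] amp_pos[of r] by simp
  qed simp
  also have "ip (\<lambda>r. Im (F r) / amp r) g = ip (\<lambda>_. 0) g"
    using F by (intro ip_cong) auto
  also have "ip (\<lambda>_. 0) g = 0" by (simp add: ip_def)
  finally show ?thesis by (simp add: complex_eq_iff)
qed

lemma norm_rho_real: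
  assumes "continuous_on {r1..r2} f" "\<And>r. r \<in> {r1..r2} \<Longrightarrow> F r = complex_of_real (amp r * f r)"
  shows "norm_rho r0 r1 r2 F = sqrt (ip f f)"
  using inner_rho_real[OF assms(1) assms(1) assms(2) assms(2)] by (simp add: norm_rho_def)

lemma L2_rho_real:
  assumes f: "continuous_on {r1..r2} f" and F: "\<And>r. r \<in> {r1..r2} \<Longrightarrow> F r = complex_of_real (amp r * f r)"
  shows "F \<in> L2_rho r0 r1 r2"
proof -
  have "continuous_on {r1..r2} (\<lambda>r. complex_of_real (amp r * f r))"
    using f amp_cont by (intro continuous_intros)
  then have Fc: "continuous_on {r1..r2} F" by (rule continuous_on_eq) (simp add: F)
  then have "continuous_on {r1..r2} (\<lambda>r. (cmod (F r))\<^sup>2 * rho r0 r)"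
    using rho_cont by (intro continuous_intros)
  then show ?thesis
    using continuous_imp_integrable_real[OF Fc] continuous_imp_integrable_real
    by (auto simp: L2_rho_def)
qed

end

section \<open>Transformation of the given eigenfunctions\<close>

locale dispersive_eigenbasis = dispersive_medium +
  fixes R :: "nat \<Rightarrow> real \<Rightarrow> real" and lam :: "nat \<Rightarrow> real"
  assumes basis: "orthonormal_basis_rho r0 r1 r2 (\<lambda>m r. complex_of_real (R m r))"
    and lam_pos': "m \<ge> 1 \<Longrightarrow> 0 < lam m"
    and eigen: "m \<ge> 1 \<Longrightarrow> SL_eigenfunction r0 r1 r2 (lam m) (R m)"
    and lam_mono': "1 \<le> m \<Longrightarrow> m \<le> k \<Longrightarrow> (lam m)\<^sup>2 \<le> (lam k)\<^sup>2"
    and sign: "m \<ge> 1 \<Longrightarrow> vector_derivative (R m) (at r1 within {r1..r2}) > 0"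
begin

definition pR' :: "nat \<Rightarrow> real \<Rightarrow> real"
  where "pR' m r = p_coeff r * vector_derivative (R m) (at r within {r1..r2})"

definition w :: "nat \<Rightarrow> real \<Rightarrow> real" where "w m r = R m r / amp r"

text \<open>This is the Wronskian-like expression p (amp R' - amp' R) = p amp^2 (R / amp)', which
  \<open>amp_speed\<close> identifies as the X-derivative of w. When it is differentiated, the two
  mixed products of \<open>flux\<close> and \<open>pR'\<close> cancel.\<close>

definition v :: "nat \<Rightarrow> real \<Rightarrow> real" where "v m r = amp r * pR' m r - flux r * R m r"

lemma R_eq: "r \<in> {r1..r2} \<Longrightarrow> complex_of_real (R m r) = complex_of_real (amp r * w m r)"
  using amp_pos[of r] by (simp add: w_def)

lemma R_deriv:
  assumes "m \<ge> 1" "r \<in> {r1..r2}"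
  shows "(R m has_real_derivative r * pR' m r) (at r within {r1..r2})"
proof -
  have "R m differentiable (at r within {r1..r2})"
    using eigen[OF assms(1)] assms(2) by (auto simp: SL_eigenfunction_def differentiable_on_def)
  then have "(R m has_real_derivative vector_derivative (R m) (at r within {r1..r2})) (at r within {r1..r2})"
    by (simp add: vector_derivative_works has_real_derivative_iff_has_vector_derivative)
  then show ?thesis using r_pos[OF assms(2)] by (simp add: pR'_def p_coeff_def)
qed

lemma pR'_deriv:
  assumes "m \<ge> 1" "r \<in> {r1..r2}"
  shows "(pR' m has_real_derivative - ((lam m)\<^sup>2 * rho r0 r * R m r)) (at r within {r1..r2})"
  using eigen[OF assms(1)] assms(2) by (auto simp: SL_eigenfunction_def pR'_def[abs_def])

lemma w_X_deriv:
  assumes m: "m \<ge> 1"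
  shows "has_X_deriv (w m) (v m)"
  unfolding has_X_deriv_def
proof
  fix r assume r: "r \<in> {r1..r2}"
  have nz: "amp r \<noteq> 0" using amp_pos[OF r] by simp
  have "(w m has_real_derivative (r * pR' m r * amp r - R m r * (r * flux r)) / (amp r * amp r)) (at r within {r1..r2})"
    unfolding w_def
    by (intro DERIV_divide R_deriv m r nz has_field_derivative_at_within[OF amp_deriv[OF r]])
  also have "(r * pR' m r * amp r - R m r * (r * flux r)) / (amp r * amp r) = v m r * (r / (amp r * amp r))"
  proof -
    have "r * pR' m r * amp r - R m r * (r * flux r) = v m r * r" by (simp add: v_def algebra_simps)
    then show ?thesis by simp
  qed
  also have "r / (amp r * amp r) = speed r"
    using amp_speed[OF r] nz by (simp add: field_simps)
  finally show "(w m has_real_derivative v m r * speed r) (at r within {r1..r2})" .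
qed

lemma v_X_deriv:
  assumes m: "m \<ge> 1"
  shows "has_X_deriv (v m) (\<lambda>r. (potential r - (lam m)\<^sup>2) * w m r)"
  unfolding has_X_deriv_def
proof
  fix r assume r: "r \<in> {r1..r2}"
  have nz: "amp r \<noteq> 0" "speed r \<noteq> 0" using amp_pos[OF r] speed_pos[OF r] by simp_all
  have "(v m has_real_derivative
      (r * flux r * pR' m r + - ((lam m)\<^sup>2 * rho r0 r * R m r) * amp r)
      - (flux' r * R m r + r * pR' m r * flux r)) (at r within {r1..r2})"
    unfolding v_def
    by (intro DERIV_diff DERIV_mult R_deriv pR'_deriv m r
        has_field_derivative_at_within[OF amp_deriv[OF r]] has_field_derivative_at_within[OF flux_deriv[OF r]])
  also have "(r * flux r * pR' m r + - ((lam m)\<^sup>2 * rho r0 r * R m r) * amp r)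
      - (flux' r * R m r + r * pR' m r * flux r)
      = - (flux' r + (lam m)\<^sup>2 * (amp r * rho r0 r)) * R m r"
    by (simp add: algebra_simps)
  also have "amp r * rho r0 r = speed r / amp r"
    using amp_rho[OF r] nz by (simp add: field_simps)
  also have "- (flux' r + (lam m)\<^sup>2 * (speed r / amp r)) * R m r = (potential r - (lam m)\<^sup>2) * w m r * speed r"
    using nz by (simp add: potential_def w_def field_simps)
  finally show "(v m has_real_derivative (potential r - (lam m)\<^sup>2) * w m r * speed r) (at r within {r1..r2})" .
qed

lemma w_continuous: "m \<ge> 1 \<Longrightarrow> continuous_on {r1..r2} (w m)"
  using w_X_deriv has_X_deriv_cont by blast

sublocale liouville_eigenbasis r1 r2 "xi r0 r1" speed potential "SUP r\<in>{r1..r2}. \<bar>potential r\<bar>" w v lam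
proof
  fix m :: nat assume m: "m \<ge> 1"
  show "w m r1 = 0" "w m r2 = 0" using eigen[OF m] by (auto simp: w_def SL_eigenfunction_def)
  \<comment> \<open>At r1 the term with \<open>flux\<close> drops out, so the sign convention for R'
    becomes positivity of v.\<close>
  have "R m r1 = 0" using eigen[OF m] by (simp add: SL_eigenfunction_def)
  then show "0 < v m r1" using sign[OF m] amp_pos[of r1] radii
    by (simp add: v_def pR'_def p_coeff_def)
next
  fix m n :: nat assume "m \<ge> 1" "n \<ge> 1"
  then have "complex_of_real (ip (w m) (w n)) = (if m = n then 1 else 0)"
    using basis inner_rho_real[OF w_continuous w_continuous R_eq R_eq, of m n]
    by (simp add: orthonormal_basis_rho_def)
  then show "ip (w m) (w n) = (if m = n then 1 else 0)" by (auto split: if_splits)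
next
  fix f :: "real \<Rightarrow> real" assume f: "continuous_on {r1..r2} f"
  \<comment> \<open>Multiplication by amp carries the expansion of f in the w k into that of
    \<open>F\<close> in the R k, with the same coefficients; \<open>e N\<close> is the residual
    before multiplication.\<close>
  define F where "F = (\<lambda>r. complex_of_real (amp r * f r))"
  define e where "e = (\<lambda>N r. f r - (\<Sum>k=1..N. ip f (w k) * w k r))"
  have e: "continuous_on {r1..r2} (e N)" for N
    unfolding e_def using f w_continuous by (auto intro!: continuous_intros)
  have "F \<in> L2_rho r0 r1 r2" by (rule L2_rho_real[OF f]) (simp add: F_def)
  then have lim: "(\<lambda>N. norm_rho r0 r1 r2 (\<lambda>r. F r - (\<Sum>k=1..N. inner_rho r0 r1 r2 F (\<lambda>r. complex_of_real (R k r)) * complex_of_real (R k r)))) \<longlonglongrightarrow> 0"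
    using basis by (simp add: orthonormal_basis_rho_def expands_in_rho_def)
  have "norm_rho r0 r1 r2 (\<lambda>r. F r - (\<Sum>k=1..N. inner_rho r0 r1 r2 F (\<lambda>r. complex_of_real (R k r)) * complex_of_real (R k r)))
      = sqrt (ip (e N) (e N))" for N
  proof (rule norm_rho_real[OF e])
    fix r assume r: "r \<in> {r1..r2}"
    have "inner_rho r0 r1 r2 F (\<lambda>r. complex_of_real (R k r)) = complex_of_real (ip f (w k))" if "k \<ge> 1" for k
      by (rule inner_rho_real[OF f w_continuous[OF that] _ R_eq]) (simp_all add: F_def)
    then have "(\<Sum>k=1..N. inner_rho r0 r1 r2 F (\<lambda>r. complex_of_real (R k r)) * complex_of_real (R k r))
        = (\<Sum>k=1..N. complex_of_real (amp r * (ip f (w k) * w k r)))"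
      using R_eq[OF r] by (intro sum.cong) (auto simp: mult_ac)
    then show "F r - (\<Sum>k=1..N. inner_rho r0 r1 r2 F (\<lambda>r. complex_of_real (R k r)) * complex_of_real (R k r))
        = complex_of_real (amp r * e N r)"
      by (simp add: F_def e_def right_diff_distrib sum_distrib_left)
  qed
  with lim have "(\<lambda>N. sqrt (ip (e N) (e N))) \<longlonglongrightarrow> 0" by simp
  then have "(\<lambda>N. (sqrt (ip (e N) (e N)))\<^sup>2) \<longlonglongrightarrow> 0\<^sup>2" by (rule tendsto_power)
  moreover have "(sqrt (ip (e N) (e N)))\<^sup>2 = ip (e N) (e N)" for N
    using ip_nonneg[OF e] by simp
  ultimately show "(\<lambda>N. ip (\<lambda>r. f r - (\<Sum>k=1..N. ip f (w k) * w k r)) (\<lambda>r. f r - (\<Sum>k=1..N. ip f (w k) * w k r)))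
        \<longlonglongrightarrow> 0"
    by (simp only: e_def power_zero_numeral)
qed (use w_X_deriv v_X_deriv lam_pos' lam_mono' in auto)

section \<open>Estimates for the remainder between eigenfunction and sine\<close>

lemma LG_eq: "r \<in> {r1..r2} \<Longrightarrow> complex_of_real (R_LG r0 r1 r2 m r) = complex_of_real (amp r * sine m r)"
  by (simp add: R_LG_eq)

lemma remainder_cont: "m \<ge> 1 \<Longrightarrow> continuous_on {r1..r2} (\<lambda>r. w m r - sine m r)"
  using w_cont sine_cont by (intro continuous_intros) auto

lemma remainder_norm:
  obtains K N where "0 \<le> K" "1 \<le> N"
    "\<And>m. m \<ge> N \<Longrightarrow> sqrt (ip (\<lambda>r. w m r - sine m r) (\<lambda>r. w m r - sine m r)) \<le> K * (1 / real m)"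
proof -
  obtain K N where K: "0 \<le> K" "1 \<le> N"
    "\<And>n r. n \<ge> N \<Longrightarrow> r \<in> {r1..r2} \<Longrightarrow> \<bar>w n r - sine n r\<bar> \<le> K / real n"
    using eigenfunction_asymptotics by blast
  have "sqrt (ip (\<lambda>r. w m r - sine m r) (\<lambda>r. w m r - sine m r)) \<le> (K * sqrt len) * (1 / real m)"
    if m: "m \<ge> N" for m
  proof -
    have "ip (\<lambda>r. w m r - sine m r) (\<lambda>r. w m r - sine m r) \<le> ip (\<lambda>_. K / real m) (\<lambda>_. K / real m)"
    proof (rule ip_mono)
      fix r assume "r \<in> {r1..r2}"
      then have "\<bar>w m r - sine m r\<bar> * \<bar>w m r - sine m r\<bar> \<le> K / real m * (K / real m)"
        using K(3)[OF m] K(1) by (intro mult_mono) auto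
      then show "(w m r - sine m r) * (w m r - sine m r) \<le> K / real m * (K / real m)"
        by (simp only: abs_mult_self_eq)
    qed (use remainder_cont[of m] m K(2) in auto)
    then have "sqrt (ip (\<lambda>r. w m r - sine m r) (\<lambda>r. w m r - sine m r)) \<le> sqrt (K / real m * (K / real m) * len)"
      unfolding ip_const by (rule real_sqrt_le_mono)
    also have "\<dots> = (K * sqrt len) * (1 / real m)"
      using K(1) by (simp only: real_sqrt_mult real_sqrt_abs2) simp
    finally show ?thesis .
  qed
  then show ?thesis using that[of "K * sqrt len" N] K len_pos by auto
qed

lemma ip_remainder_le:
  assumes "m \<ge> 1" "continuous_on {r1..r2} g"
  shows "\<bar>ip g (\<lambda>r. w m r - sine m r)\<bar>
    \<le> sqrt (ip g g) * sqrt (ip (\<lambda>r. w m r - sine m r) (\<lambda>r. w m r - sine m r))"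
  using real_sqrt_le_mono[OF ip_Cauchy_Schwarz[OF assms(2) remainder_cont[OF assms(1)]]]
  by (simp add: real_sqrt_mult)

lemma ip_remainder:
  assumes "m \<ge> 1" "continuous_on {r1..r2} g"
  shows "ip g (\<lambda>r. w m r - sine m r) = ip g (w m) - ip g (sine m)"
  using ip_diff_left[OF w_cont[OF assms(1)] sine_cont[of m] assms(2)] by (simp add: ip_commute)

text \<open>This gives both estimates of (iv). The remainder is real, so Cauchy-Schwarz is applied
  to the real and the imaginary part of F / amp separately, and their norms add up to
  \<open>c\<close>.\<close>

lemma inner_remainder_bigo:
  assumes F: "continuous_on {r1..r2} F"
  shows "(\<lambda>m. inner_rho r0 r1 r2 F (\<lambda>r. complex_of_real (R m r))
      - inner_rho r0 r1 r2 F (\<lambda>r. complex_of_real (R_LG r0 r1 r2 m r))) \<in> O(\<lambda>m. 1 / of_nat m)"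
proof -
  obtain K N where K: "0 \<le> K" "1 \<le> N"
    "\<And>m. m \<ge> N \<Longrightarrow> sqrt (ip (\<lambda>r. w m r - sine m r) (\<lambda>r. w m r - sine m r)) \<le> K * (1 / real m)"
    using remainder_norm by blast
  define f where "f = (\<lambda>r. Re (F r) / amp r)"
  define g where "g = (\<lambda>r. Im (F r) / amp r)"
  have fg: "continuous_on {r1..r2} f" "continuous_on {r1..r2} g"
    unfolding f_def g_def using F amp_cont amp_pos
    by (intro continuous_intros, auto simp: less_le)+
  define c where "c = sqrt (ip f f) + sqrt (ip g g)"
  have c0: "0 \<le> c"
    unfolding c_def using fg by (intro add_nonneg_nonneg real_sqrt_ge_zero ip_nonneg)
  show ?thesis
  proof (rule bigoI[of _ "c * K"], rule eventually_sequentiallyI[of N])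
    fix m assume m: "N \<le> m"
    then have m1: "m \<ge> 1" using K(2) by simp
    let ?d = "\<lambda>r. w m r - sine m r"
    have "inner_rho r0 r1 r2 F (\<lambda>r. complex_of_real (R m r)) = Complex (ip f (w m)) (ip g (w m))"
      unfolding f_def g_def by (rule inner_rho_eq[OF F w_cont[OF m1] R_eq])
    moreover have "inner_rho r0 r1 r2 F (\<lambda>r. complex_of_real (R_LG r0 r1 r2 m r))
        = Complex (ip f (sine m)) (ip g (sine m))"
      unfolding f_def g_def by (rule inner_rho_eq[OF F sine_cont LG_eq])
    ultimately have "inner_rho r0 r1 r2 F (\<lambda>r. complex_of_real (R m r))
        - inner_rho r0 r1 r2 F (\<lambda>r. complex_of_real (R_LG r0 r1 r2 m r)) = Complex (ip f ?d) (ip g ?d)"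
      by (simp add: complex_eq_iff ip_remainder[OF m1] fg)
    then have "cmod (inner_rho r0 r1 r2 F (\<lambda>r. complex_of_real (R m r))
        - inner_rho r0 r1 r2 F (\<lambda>r. complex_of_real (R_LG r0 r1 r2 m r))) \<le> \<bar>ip f ?d\<bar> + \<bar>ip g ?d\<bar>"
      using cmod_le[of "Complex (ip f ?d) (ip g ?d)"] by simp
    also have "\<dots> \<le> c * sqrt (ip ?d ?d)"
      unfolding c_def distrib_right by (intro add_mono ip_remainder_le m1 fg)
    also have "\<dots> \<le> c * (K * (1 / real m))"
      by (rule mult_left_mono[OF K(3)[OF m] c0])
    finally show "cmod (inner_rho r0 r1 r2 F (\<lambda>r. complex_of_real (R m r))
        - inner_rho r0 r1 r2 F (\<lambda>r. complex_of_real (R_LG r0 r1 r2 m r)))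
        \<le> c * K * cmod (1 / of_nat m)"
      by (simp only: norm_divide norm_one norm_of_nat mult.assoc)
  qed
qed

text \<open>In each inner product the function with index m is exchanged for its counterpart at the
  price of the remainder, which is then paired with a unit vector of index k. The bound is therefore
  uniform in k, and one K serves all claims. The \<open>of_bool\<close> term covers the diagonal and
  the off-diagonal coefficients of (iii) together.\<close>

lemma Liouville_Green_asymptotics:
  defines "RC \<equiv> (\<lambda>m r. complex_of_real (R m r))"
    and "LG \<equiv> (\<lambda>m r. complex_of_real (R_LG r0 r1 r2 m r))"
  shows "\<exists>K. eventually (\<lambda>m. norm_rho r0 r1 r2 (\<lambda>r. RC m r - LG m r) \<in> {0..K * (1 / real m)} \<and>
    (\<forall>k\<ge>1. k \<noteq> m \<longrightarrow> cmod (inner_rho r0 r1 r2 (RC m) (LG k)) \<le> K * (1 / real m)) \<and>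
    (\<forall>k\<ge>1. cmod (inner_rho r0 r1 r2 (LG m) (RC k) - of_bool (k = m)) \<le> K * (1 / real m))) sequentially"
proof -
  obtain K N where K: "0 \<le> K" "1 \<le> N"
    "\<And>m. m \<ge> N \<Longrightarrow> sqrt (ip (\<lambda>r. w m r - sine m r) (\<lambda>r. w m r - sine m r)) \<le> K * (1 / real m)"
    using remainder_norm by blast
  have unit: "\<bar>ip g (\<lambda>r. w m r - sine m r)\<bar> \<le> K * (1 / real m)"
    if "m \<ge> N" "continuous_on {r1..r2} g" "ip g g = 1" for m g
    using ip_remainder_le[of m g] K(2) K(3)[OF that(1)] that by simp
  show ?thesis
  proof (intro exI[of _ K] eventually_sequentiallyI[of N] conjI allI impI)
    fix m assume m: "N \<le> m"
    then have m1: "m \<ge> 1" using K(2) by simp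
    have "norm_rho r0 r1 r2 (\<lambda>r. RC m r - LG m r)
        = sqrt (ip (\<lambda>r. w m r - sine m r) (\<lambda>r. w m r - sine m r))"
      by (rule norm_rho_real[OF remainder_cont[OF m1]])
        (simp add: RC_def LG_def R_eq LG_eq right_diff_distrib)
    then show "norm_rho r0 r1 r2 (\<lambda>r. RC m r - LG m r) \<in> {0..K * (1 / real m)}"
      using K(3)[OF m] ip_nonneg[OF remainder_cont[OF m1]] by simp
    fix k :: nat assume k: "1 \<le> k"
    have "inner_rho r0 r1 r2 (LG m) (RC k) = complex_of_real (ip (sine m) (w k))"
      unfolding RC_def LG_def by (rule inner_rho_real[OF sine_cont w_cont[OF k] LG_eq R_eq])
    moreover have "ip (sine m) (w k) = of_bool (k = m) - ip (w k) (\<lambda>r. w m r - sine m r)"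
      using ip_remainder[OF m1 w_cont[OF k]] w_orthonormal[OF k m1]
      by (simp add: ip_commute[of "sine m" "w k"])
    ultimately have "inner_rho r0 r1 r2 (LG m) (RC k) - of_bool (k = m)
        = - complex_of_real (ip (w k) (\<lambda>r. w m r - sine m r))"
      by (cases "k = m") simp_all
    then show "cmod (inner_rho r0 r1 r2 (LG m) (RC k) - of_bool (k = m)) \<le> K * (1 / real m)"
      using unit[OF m w_cont[OF k]] w_orthonormal[OF k k] by simp
    assume "k \<noteq> m"
    have "inner_rho r0 r1 r2 (RC m) (LG k) = complex_of_real (ip (w m) (sine k))"
      unfolding RC_def LG_def by (rule inner_rho_real[OF w_cont[OF m1] sine_cont R_eq LG_eq])
    moreover have "ip (w m) (sine k) = ip (sine k) (\<lambda>r. w m r - sine m r)"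
      using ip_remainder[OF m1 sine_cont[of k]] sine_orthonormal[OF k m1] \<open>k \<noteq> m\<close>
      by (simp add: ip_commute[of "w m" "sine k"])
    ultimately show "cmod (inner_rho r0 r1 r2 (RC m) (LG k)) \<le> K * (1 / real m)"
      using unit[OF m sine_cont[of k]] sine_orthonormal[OF k k] by simp
  qed
qed

lemma R_LG_in_L2_rho: "(\<lambda>r. complex_of_real (R_LG r0 r1 r2 m r)) \<in> L2_rho r0 r1 r2"
  by (rule L2_rho_real[OF sine_cont LG_eq])

end

section \<open>Assembly of the four claims\<close>

lemma Ck_on_continuous: "Ck_on n a b f \<Longrightarrow> continuous_on {a..b} f"
proof -
  assume "Ck_on n a b f"
  then obtain D where D: "\<forall>x\<in>{a..b}. D 0 x = f x"
    "\<forall>j<n. \<forall>x\<in>{a..b}. (D j has_vector_derivative D (Suc j) x) (at x within {a..b})"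
    "continuous_on {a..b} (D n)"
    by (auto simp: Ck_on_def)
  have "continuous_on {a..b} (D 0)"
  proof (cases n)
    case (Suc k)
    then show ?thesis
      using D(2) has_vector_derivative_continuous
      by (fastforce simp: continuous_on_eq_continuous_within)
  qed (use D(3) in simp)
  then show ?thesis by (rule continuous_on_eq) (use D(1) in blast)
qed

theorem mainTheorem6:
  fixes r0 r1 r2 :: real
    and R :: "nat \<Rightarrow> real \<Rightarrow> real"
    and lam :: "nat \<Rightarrow> real"
  defines "RC \<equiv> (\<lambda>m r. complex_of_real (R m r))"
    and "LG \<equiv> (\<lambda>m r. complex_of_real (R_LG r0 r1 r2 m r))"
  assumes "0 < r0" and "r0 < r1" and "r1 < r2"
    and "orthonormal_basis_rho r0 r1 r2 RC"
    and "\<And>m. m \<ge> 1 \<Longrightarrow> 0 < lam m"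
    and "\<And>m. m \<ge> 1 \<Longrightarrow> SL_eigenfunction r0 r1 r2 (lam m) (R m)"
    and "\<And>m k. 1 \<le> m \<Longrightarrow> m \<le> k \<Longrightarrow> (lam m)\<^sup>2 \<le> (lam k)\<^sup>2"
    and "\<And>m. m \<ge> 1 \<Longrightarrow> vector_derivative (R m) (at r1 within {r1..r2}) > 0"
  shows
    "(\<lambda>m. norm_rho r0 r1 r2 (\<lambda>r. RC m r - LG m r)) \<in> O(\<lambda>m. 1 / real m)
     \<and>
     (\<exists>C. \<forall>\<^sub>F m in sequentially. \<forall>k\<ge>1. k \<noteq> m \<longrightarrow>
        cmod (inner_rho r0 r1 r2 (RC m) (LG k)) \<le> C * (1 / real m))
     \<and>
     (\<forall>m\<ge>1. expands_in_rho r0 r1 r2 (LG m) (\<lambda>k. inner_rho r0 r1 r2 (LG m) (RC k)) RC) \<and>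
     (\<lambda>m. inner_rho r0 r1 r2 (LG m) (RC m) - 1) \<in> O(\<lambda>m. 1 / of_nat m) \<and>
     (\<exists>C. \<forall>\<^sub>F m in sequentially. \<forall>k\<ge>1. k \<noteq> m \<longrightarrow>
        cmod (inner_rho r0 r1 r2 (LG m) (RC k)) \<le> C * (1 / real m))
     \<and>
     (\<forall>\<phi>. Ck_on 3 r1 r2 \<phi> \<longrightarrow>
        (\<exists>g\<in>L2_rho r0 r1 r2. weak_derivative 4 r1 r2 \<phi> g) \<longrightarrow>
        (\<lambda>m. inner_rho r0 r1 r2 \<phi> (RC m) - inner_rho r0 r1 r2 \<phi> (LG m))
          \<in> O(\<lambda>m. 1 / of_nat m)) \<and>
     (\<forall>\<psi>. Ck_on 1 r1 r2 \<psi> \<longrightarrow>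
        (\<exists>g\<in>L2_rho r0 r1 r2. weak_derivative 2 r1 r2 \<psi> g) \<longrightarrow>
        (\<lambda>m. inner_rho r0 r1 r2 \<psi> (RC m) - inner_rho r0 r1 r2 \<psi> (LG m))
          \<in> O(\<lambda>m. 1 / of_nat m))"
proof -
  note RC_def = assms(1) and LG_def = assms(2) and basis = assms(6)[unfolded RC_def]
  interpret dispersive_eigenbasis r0 r1 r2 R lam
    by unfold_locales (fact basis assms)+
  have "\<exists>K. eventually (\<lambda>m. norm_rho r0 r1 r2 (\<lambda>r. RC m r - LG m r) \<in> {0..K * (1 / real m)} \<and>
      (\<forall>k\<ge>1. k \<noteq> m \<longrightarrow> cmod (inner_rho r0 r1 r2 (RC m) (LG k)) \<le> K * (1 / real m)) \<and>
      (\<forall>k\<ge>1. cmod (inner_rho r0 r1 r2 (LG m) (RC k) - of_bool (k = m)) \<le> K * (1 / real m))) sequentially"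
    unfolding RC_def LG_def by (rule Liouville_Green_asymptotics)
  then obtain K where K: "eventually (\<lambda>m. norm_rho r0 r1 r2 (\<lambda>r. RC m r - LG m r) \<in> {0..K * (1 / real m)} \<and>
      (\<forall>k\<ge>1. k \<noteq> m \<longrightarrow> cmod (inner_rho r0 r1 r2 (RC m) (LG k)) \<le> K * (1 / real m)) \<and>
      (\<forall>k\<ge>1. cmod (inner_rho r0 r1 r2 (LG m) (RC k) - of_bool (k = m)) \<le> K * (1 / real m))) sequentially"
    by (rule exE)
  show ?thesis
  proof (intro conjI allI impI)
    show "(\<lambda>m. norm_rho r0 r1 r2 (\<lambda>r. RC m r - LG m r)) \<in> O(\<lambda>m. 1 / real m)"
      by (intro bigoI[of _ K] eventually_mono[OF K]) simp
    show "\<exists>C. \<forall>\<^sub>F m in sequentially. \<forall>k\<ge>1. k \<noteq> m \<longrightarrow>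
        cmod (inner_rho r0 r1 r2 (RC m) (LG k)) \<le> C * (1 / real m)"
      by (intro exI[of _ K] eventually_mono[OF K]) blast
    show "expands_in_rho r0 r1 r2 (LG m) (\<lambda>k. inner_rho r0 r1 r2 (LG m) (RC k)) RC" for m
      using assms(6) R_LG_in_L2_rho unfolding orthonormal_basis_rho_def LG_def by blast
    show "(\<lambda>m. inner_rho r0 r1 r2 (LG m) (RC m) - 1) \<in> O(\<lambda>m. 1 / of_nat m)"
    \<comment> \<open>The bound is used at k = m, which requires m \<ge> 1; hence the second
      eventual condition.\<close>
    proof (intro bigoI[of _ K] eventually_mono[OF eventually_conj[OF K eventually_ge_at_top[of 1]]], elim conjE)
      fix m :: nat
      assume "\<forall>k\<ge>1. cmod (inner_rho r0 r1 r2 (LG m) (RC k) - of_bool (k = m)) \<le> K * (1 / real m)" "1 \<le> m"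
      then show "cmod (inner_rho r0 r1 r2 (LG m) (RC m) - 1) \<le> K * cmod (1 / of_nat m)"
        by (auto simp: norm_divide dest!: spec[of _ m])
    qed
    show "\<exists>C. \<forall>\<^sub>F m in sequentially. \<forall>k\<ge>1. k \<noteq> m \<longrightarrow>
        cmod (inner_rho r0 r1 r2 (LG m) (RC k)) \<le> C * (1 / real m)"
    proof (intro exI[of _ K] eventually_mono[OF K] allI impI, elim conjE)
      fix m k :: nat
      assume "\<forall>k\<ge>1. cmod (inner_rho r0 r1 r2 (LG m) (RC k) - of_bool (k = m)) \<le> K * (1 / real m)" "1 \<le> k" "k \<noteq> m"
      then show "cmod (inner_rho r0 r1 r2 (LG m) (RC k)) \<le> K * (1 / real m)"
        by (auto dest!: spec[of _ k])
    qed
  qed (unfold RC_def LG_def, (rule inner_remainder_bigo, erule Ck_on_continuous)+)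
qed

end
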